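(* Let $n\ge 2$. If $t \in \Delta_n$ is a special vertex, then the number $\omega(\Delta_n)$ of vertices in $\Delta_n$ close to $t$ is $$\frac{q^{2n} - 1}{q - 1} \cdot q$$ (independent of $t$).
   Context: $K$ is a (nonarchimedean) local field with discrete valuation $\mathrm{ord}$, valuation ring $\mathcal{O}$, uniformizer $\pi$ and residue field $k \cong \mathbb{F}_q$. Let $V$ be a $2n$-dimensional $K$-vector space with a non-degenerate alternating bilinear form $\langle\cdot,\cdot\rangle$. A lattice in $V$ is a free $\mathcal{O}$-submodule of rank $2n$; $[L]$ is the homothety class $\{\alpha L : \alpha\in K^\times\}$. A lattice $L$ is primitive if $\langle L,L\rangle\subseteq\mathcal{O}$ and $\langle\cdot,\cdot\rangle$ induces a non-degenerate alternating $k$-bilinear form on $L/\pi L$. The affine building $\Delta_n$ of $\mathrm{Sp}_n(K)$ (the symplectic group of $2n\times 2n$ matrices) is the following $n$-dimensional simplicial complex. A vertex is a homothety class of lattices in $V$ having a representative $L$ for which there is a primitive lattice $L_0$ with $\langle L,L\rangle\subseteq\pi\mathcal{O}$ and $\pi L_0\subseteq L\subseteq L_0$. Vertices $t,t'$ are incident if there are $L\in t$, $L'\in t'$ and a primitive lattice $L_0$ with $\langle L,L\rangle\subseteq\pi\mathcal{O}$, $\langle L',L'\rangle\subseteq\pi\mathcal{O}$, and either $\pi L_0\subseteq L\subseteq L'\subseteq L_0$ or $\pi L_0\subseteq L'\subseteq L\subseteq L_0$. Simplices are the finite sets of pairwise incident vertices. A chamber (maximal simplex) has $n+1$ vertices $t_0,\dots,t_n$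 with representatives $L_i\in t_i$ such that $L_0$ is primitive, $\langle L_i,L_i\rangle\subseteq\pi\mathcal{O}$ for $1\le i\le n$, and $\pi L_0\subsetneq L_1\subsetneq\cdots\subsetneq L_n\subsetneq L_0$. Two chambers are adjacent if they share a codimension-one face. Two vertices $t,t'$ of $\Delta_n$ are close if there are adjacent chambers $C,C'$ in $\Delta_n$ with $t\in C$, $t'\in C'$, but $t,t'\notin C\cap C'$. A basis $\{u_1,\dots,u_n,w_1,\dots,w_n\}$ of $V$ is symplectic if $\langle u_i,w_j\rangle=\delta_{ij}$ and $\langle u_i,u_j\rangle=0=\langle w_i,w_j\rangle$ for all $i,j$. A vertex $t$ of $\Delta_n$ is special (in the usual sense for affine buildings) if and only if there are a symplectic basis of $V$ and integers $a_1,\dots,a_n,\mu$ with $t=[\sum_i \mathcal{O}\pi^{a_i}u_i+\sum_i\mathcal{O}\pi^{\mu-a_i}w_i]$; this may be taken as the definition. *)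

theory Defs
  imports Complex_Main
begin

text \<open>The value \<open>ord 0\<close> is arbitrary: it stands for \<open>\<infinity>\<close> and never enters below.
  Normalisation (\<open>ord\<close> is onto the integers) is part of \<open>ord unif = 1\<close>.\<close>

locale discretely_valued_field =
  fixes ord :: "'k::field \<Rightarrow> int" and unif :: 'k
  assumes ord_mult: "\<And>x y. x \<noteq> 0 \<Longrightarrow> y \<noteq> 0 \<Longrightarrow> ord (x * y) = ord x + ord y"
    and ord_add: "\<And>x y. x \<noteq> 0 \<Longrightarrow> y \<noteq> 0 \<Longrightarrow> x + y \<noteq> 0 \<Longrightarrow> min (ord x) (ord y) \<le> ord (x + y)"
    and unif_nonzero: "unif \<noteq> 0"
    and ord_unif: "ord unif = 1"
begin

definition val_ge :: "'k \<Rightarrow> int \<Rightarrow> bool" where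
  "val_ge x N \<longleftrightarrow> x = 0 \<or> N \<le> ord x"

definition val_ring :: "'k set" where
  "val_ring = {x. val_ge x 0}"

definition max_ideal :: "'k set" where
  "max_ideal = (*) unif ` val_ring"

definition residue_class :: "'k \<Rightarrow> 'k set" where
  "residue_class x = (+) x ` max_ideal"

definition residue_field :: "'k set set" where
  "residue_field = residue_class ` val_ring"

definition val_Cauchy :: "(nat \<Rightarrow> 'k) \<Rightarrow> bool" where
  "val_Cauchy s \<longleftrightarrow> (\<forall>N. \<exists>M. \<forall>i\<ge>M. \<forall>j\<ge>M. val_ge (s i - s j) N)"

definition val_tendsto :: "(nat \<Rightarrow> 'k) \<Rightarrow> 'k \<Rightarrow> bool" where
  "val_tendsto s l \<longleftrightarrow> (\<forall>N. \<exists>M. \<forall>i\<ge>M. val_ge (s i - l) N)"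

end

locale nonarch_local_field = discretely_valued_field ord unif
  for ord :: "'k::field \<Rightarrow> int" and unif :: 'k +
  assumes complete: "\<And>s. val_Cauchy s \<Longrightarrow> \<exists>l. val_tendsto s l"
    and finite_residue_field: "finite residue_field"

text \<open>\<open>dim\<close> is 0 for spaces without a finite basis, so for \<open>n > 0\<close> the assumption \<open>dim_UNIV\<close>
  includes finite-dimensionality.\<close>

locale symplectic_space =
  nonarch_local_field ord unif + vector_space scale
  for ord :: "'k::field \<Rightarrow> int" and unif :: 'k
    and scale :: "'k \<Rightarrow> 'v::ab_group_add \<Rightarrow> 'v" +
  fixes form :: "'v \<Rightarrow> 'v \<Rightarrow> 'k" and n :: nat
  assumes dim_UNIV: "dim UNIV = 2 * n"
    and form_linear_right: "\<And>x. Vector_Spaces.linear scale (*) (\<lambda>y. form x y)"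
    and form_linear_left: "\<And>y. Vector_Spaces.linear scale (*) (\<lambda>x. form x y)"
    and form_alternating: "\<And>x. form x x = 0"
    and form_nondegenerate: "\<And>x. (\<And>y. form x y = 0) \<Longrightarrow> x = 0"
begin

definition O_span :: "'v set \<Rightarrow> 'v set" where
  "O_span B = {\<Sum>b\<in>B. scale (c b) b | c. \<forall>b\<in>B. c b \<in> val_ring}"

definition O_independent :: "'v set \<Rightarrow> bool" where
  "O_independent B \<longleftrightarrow>
     (\<forall>c. (\<forall>b\<in>B. c b \<in> val_ring) \<longrightarrow> (\<Sum>b\<in>B. scale (c b) b) = 0 \<longrightarrow> (\<forall>b\<in>B. c b = 0))"

definition lattice :: "'v set \<Rightarrow> bool" where
  "lattice L \<longleftrightarrow> (\<exists>B. finite B \<and> card B = 2 * n \<and> O_independent B \<and> L = O_span B)"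

definition homothety_class :: "'v set \<Rightarrow> 'v set set" where
  "homothety_class L = {scale \<alpha> ` L | \<alpha>. \<alpha> \<noteq> 0}"

definition reduction :: "'v set \<Rightarrow> 'v set set" where
  "reduction L = (\<lambda>x. (+) x ` scale unif ` L) ` L"

text \<open>If the form is integral on \<open>L\<close>, the residue class of \<open>form x y\<close> does not depend on the
  choice of \<open>x\<close>, \<open>y\<close> in cosets \<open>X\<close>, \<open>Y\<close> of \<open>unif L\<close> in \<open>L\<close>. The union below then is this one
  element of the residue field, and the induced form is automatically bilinear and alternating.
  The zero of \<open>L / unif L\<close> is the coset \<open>unif L\<close>, that of the residue field is \<open>max_ideal\<close>.\<close>

definition induced_form :: "'v set \<Rightarrow> 'v set \<Rightarrow> 'k set" where
  "induced_form X Y = (\<Union>x\<in>X. \<Union>y\<in>Y. residue_class (form x y))"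

definition primitive :: "'v set \<Rightarrow> bool" where
  "primitive L \<longleftrightarrow> lattice L \<and> (\<forall>x\<in>L. \<forall>y\<in>L. form x y \<in> val_ring) \<and>
     (\<forall>X\<in>reduction L. (\<forall>Y\<in>reduction L. induced_form X Y = max_ideal) \<longrightarrow> X = scale unif ` L)"

definition form_in_max_ideal :: "'v set \<Rightarrow> bool" where
  "form_in_max_ideal L \<longleftrightarrow> (\<forall>x\<in>L. \<forall>y\<in>L. form x y \<in> max_ideal)"

definition vertices :: "'v set set set" where
  "vertices = {homothety_class L | L. lattice L \<and> form_in_max_ideal L \<and>
     (\<exists>L0. primitive L0 \<and> scale unif ` L0 \<subseteq> L \<and> L \<subseteq> L0)}"

definition incident :: "'v set set \<Rightarrow> 'v set set \<Rightarrow> bool" where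
  "incident t t' \<longleftrightarrow> t \<in> vertices \<and> t' \<in> vertices \<and>
     (\<exists>L\<in>t. \<exists>L'\<in>t'. \<exists>L0. primitive L0 \<and> form_in_max_ideal L \<and> form_in_max_ideal L' \<and>
        (scale unif ` L0 \<subseteq> L \<and> L \<subseteq> L' \<and> L' \<subseteq> L0 \<or>
         scale unif ` L0 \<subseteq> L' \<and> L' \<subseteq> L \<and> L \<subseteq> L0))"

definition simplex :: "'v set set set \<Rightarrow> bool" where
  "simplex S \<longleftrightarrow> finite S \<and> S \<subseteq> vertices \<and> pairwise incident S"

definition chamber :: "'v set set set \<Rightarrow> bool" where
  "chamber C \<longleftrightarrow> simplex C \<and> (\<forall>S. simplex S \<longrightarrow> C \<subseteq> S \<longrightarrow> S = C)"

definition codim_one_face :: "'v set set set \<Rightarrow> 'v set set set \<Rightarrow> bool" where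
  "codim_one_face F C \<longleftrightarrow> F \<subseteq> C \<and> card C = Suc (card F)"

definition adjacent :: "'v set set set \<Rightarrow> 'v set set set \<Rightarrow> bool" where
  "adjacent C C' \<longleftrightarrow> chamber C \<and> chamber C' \<and> (\<exists>F. codim_one_face F C \<and> codim_one_face F C')"

definition close :: "'v set set \<Rightarrow> 'v set set \<Rightarrow> bool" where
  "close t t' \<longleftrightarrow> t \<in> vertices \<and> t' \<in> vertices \<and>
     (\<exists>C C'. adjacent C C' \<and> t \<in> C \<and> t' \<in> C' \<and> t \<notin> C \<inter> C' \<and> t' \<notin> C \<inter> C')"

definition symplectic_basis :: "(nat \<Rightarrow> 'v) \<Rightarrow> (nat \<Rightarrow> 'v) \<Rightarrow> bool" where
  "symplectic_basis u w \<longleftrightarrow>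
     independent (u ` {1..n} \<union> w ` {1..n}) \<and> span (u ` {1..n} \<union> w ` {1..n}) = UNIV \<and>
     (\<forall>i\<in>{1..n}. \<forall>j\<in>{1..n}. form (u i) (w j) = (if i = j then 1 else 0) \<and>
        form (u i) (u j) = 0 \<and> form (w i) (w j) = 0)"

definition special :: "'v set set \<Rightarrow> bool" where
  "special t \<longleftrightarrow> t \<in> vertices \<and>
     (\<exists>u w a \<mu>. symplectic_basis u w \<and>
        t = homothety_class (O_span ((\<lambda>i. scale (unif powi a i) (u i)) ` {1..n} \<union>
                                     (\<lambda>i. scale (unif powi (\<mu> - a i)) (w i)) ` {1..n})))"

end

end

theory Submission
  imports Defs "HOL-Library.FuncSet"
begin

text \<open>Write \<open>\<pi>\<close> for the uniformizer and let \<open>dual j A\<close> consist of the vectors whose pairings with the lattice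
\<open>A\<close> all have valuation at least \<open>j\<close>.

A vertex of the building has exactly one representative \<open>A\<close> with
\<open>dual 2 A \<subseteq> A \<subseteq> dual 1 A\<close>, and two vertices are incident iff these representatives are comparable by
inclusion (lemmas \<open>vertices_eq\<close>, \<open>inj_on_homothety_class\<close>, \<open>incident_iff\<close>). Hence chambers are the
maximal chains of the poset \<open>vertex_lattices\<close>, and distinct \<open>A\<close>, \<open>M\<close> are close iff one can be exchanged for the
other in some maximal chain.

The representative of a special vertex satisfies \<open>dual 2 A = A\<close> or \<open>dual 1 A = A\<close>, which makes it a
minimal or a maximal element of the poset (\<open>special_vertex_lattice\<close>). The map \<open>A \<mapsto> dual 2 A\<close> reverses
inclusions and is a bijection onto the poset that belongs to the form divided by \<open>\<pi>\<close>; it turns the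
maximal case into the minimal one (\<open>close_to_maximal\<close>).

Let \<open>A\<close> be minimal and \<open>L = dual 1 A\<close>, so \<open>A = \<pi>L\<close>. In a maximal chain through \<open>A\<close> the next element is
\<open>m = A + Ox\<close> with \<open>x \<in> L - A\<close>. Such \<open>m\<close> are the lines of \<open>L / \<pi>L\<close>, a space of dimension \<open>2n\<close> over the
residue field, so there are \<open>(q\<^sup>2\<^sup>n - 1) / (q - 1)\<close> of them (\<open>card_lines\<close>). A lattice \<open>M\<close> close to \<open>A\<close>
is another minimal element below the same \<open>m\<close>. Conversely every such \<open>M\<close> is close to \<open>A\<close>, because \<open>m\<close>
covers \<open>M\<close> as well and all other members of the chain contain \<open>m\<close>. The minimal elements below \<open>m\<close> are
the lines of the plane \<open>m / dual 2 m\<close> over the residue field, \<open>q + 1\<close> in number including \<open>A\<close>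
(\<open>card_neighbours_on_line\<close>), and \<open>M\<close> determines \<open>m = A + M\<close>. Therefore the number of close vertices is
\<open>q\<close> times the number of lines.\<close>

section \<open>The valuation\<close>

context discretely_valued_field
begin

lemma ord_one [simp]: "ord 1 = 0"
  using ord_mult[of 1 1] by simp

lemma ord_uminus [simp]: "ord (- x) = ord x"
proof (cases "x = 0")
  case False
  have "ord (- 1) + ord (- 1) = ord 1"
    using ord_mult[of "- 1" "- 1"] by simp
  then have "ord (- 1) = 0" by simp
  then show ?thesis using ord_mult[of "- 1" x] False by simp
qed simp

lemma ord_inverse: "x \<noteq> 0 \<Longrightarrow> ord (inverse x) = - ord x"
  using ord_mult[of x "inverse x"] by simp

lemma ord_divide: "x \<noteq> 0 \<Longrightarrow> y \<noteq> 0 \<Longrightarrow> ord (x / y) = ord x - ord y"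
  by (simp add: divide_inverse ord_mult ord_inverse)

lemma unif_powi_nonzero [simp]: "unif powi k \<noteq> 0"
  by (simp add: unif_nonzero)

lemma ord_unif_power: "ord (unif ^ k) = int k"
  by (induction k) (simp_all add: ord_mult unif_nonzero ord_unif)

lemma ord_unif_powi [simp]: "ord (unif powi k) = k"
  by (cases "k \<ge> 0")
    (simp_all add: power_int_def ord_unif_power power_inverse ord_inverse unif_nonzero)

lemma val_ge_zero [simp]: "val_ge 0 j"
  by (simp add: val_ge_def)

lemma val_ge_one [simp]: "val_ge 1 0"
  by (simp add: val_ge_def)

lemma val_ge_unif [simp]: "val_ge unif 1"
  by (simp add: val_ge_def ord_unif)

lemma val_ge_minus_iff [simp]: "val_ge (- x) j \<longleftrightarrow> val_ge x j"
  by (simp add: val_ge_def)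

lemma val_ge_add: "val_ge x j \<Longrightarrow> val_ge y j \<Longrightarrow> val_ge (x + y) j"
  using ord_add[of x y] by (cases "x = 0"; cases "y = 0"; cases "x + y = 0") (auto simp: val_ge_def)

lemma val_ge_diff: "val_ge x j \<Longrightarrow> val_ge y j \<Longrightarrow> val_ge (x - y) j"
  using val_ge_add[of x j "- y"] by simp

lemma val_ge_mono: "val_ge x j \<Longrightarrow> i \<le> j \<Longrightarrow> val_ge x i"
  by (auto simp: val_ge_def)

lemma val_ge_mult: "val_ge x i \<Longrightarrow> val_ge y j \<Longrightarrow> val_ge (x * y) (i + j)"
  using ord_mult[of x y] by (cases "x = 0"; cases "y = 0") (auto simp: val_ge_def)

lemma val_ge_mult_left: "val_ge c 0 \<Longrightarrow> val_ge x j \<Longrightarrow> val_ge (c * x) j"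
  using val_ge_mult[of c 0 x j] by simp

lemma val_ge_cancel: "c \<noteq> 0 \<Longrightarrow> val_ge (c * x) j \<longleftrightarrow> val_ge x (j - ord c)"
  by (cases "x = 0") (auto simp: val_ge_def ord_mult)

lemma val_ge_divide: "val_ge x j \<Longrightarrow> c \<noteq> 0 \<Longrightarrow> val_ge (x / c) (j - ord c)"
  by (cases "x = 0") (auto simp: val_ge_def ord_divide)

lemma val_ge_divide_unif: "val_ge x j \<Longrightarrow> val_ge (x / unif) (j - 1)"
  using val_ge_divide[of x j unif] by (simp add: unif_nonzero ord_unif)

lemma val_ge_inverse_unit: "val_ge c 0 \<Longrightarrow> \<not> val_ge c 1 \<Longrightarrow> val_ge (inverse c) 0"
  by (auto simp: val_ge_def ord_inverse)

lemma mem_val_ring [simp]: "x \<in> val_ring \<longleftrightarrow> val_ge x 0"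
  by (simp add: val_ring_def)

lemma mem_max_ideal [simp]: "x \<in> max_ideal \<longleftrightarrow> val_ge x 1"
proof
  assume "x \<in> max_ideal"
  then show "val_ge x 1"
    using val_ge_mult[of unif 1 _ 0] by (auto simp: max_ideal_def)
next
  assume "val_ge x 1"
  then have "val_ge (x / unif) 0"
    using val_ge_divide_unif[of x 1] by simp
  then show "x \<in> max_ideal"
    unfolding max_ideal_def by (intro image_eqI[of _ _ "x / unif"]) (simp_all add: unif_nonzero)
qed

lemma mem_residue_class: "y \<in> residue_class x \<longleftrightarrow> val_ge (y - x) 1"
proof -
  have "y \<in> residue_class x \<longleftrightarrow> (\<exists>m. m \<in> max_ideal \<and> y = x + m)"
    by (auto simp: residue_class_def)
  also have "\<dots> \<longleftrightarrow> val_ge (y - x) 1"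
    by (metis add_diff_cancel_left' diff_add_cancel add.commute mem_max_ideal)
  finally show ?thesis .
qed

lemma residue_class_eq_iff: "residue_class x = residue_class y \<longleftrightarrow> val_ge (x - y) 1"
proof
  assume "residue_class x = residue_class y"
  moreover have "x \<in> residue_class x" by (simp add: mem_residue_class)
  ultimately show "val_ge (x - y) 1" by (simp add: mem_residue_class)
next
  assume xy: "val_ge (x - y) 1"
  have "val_ge (z - x) 1 \<longleftrightarrow> val_ge (z - y) 1" for z
    using val_ge_add[OF _ xy, of "z - x"] val_ge_diff[OF _ xy, of "z - y"] by auto
  then show "residue_class x = residue_class y" by (auto simp: mem_residue_class)
qed

text \<open>A set of representatives of the residue field lets sums over finite index sets replace quotient
modules in all later counts.\<close>

lemma residue_representatives:
  obtains R where "R \<subseteq> val_ring" "card R = card residue_field"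
    "\<And>x. val_ge x 0 \<Longrightarrow> \<exists>r\<in>R. val_ge (x - r) 1"
    "\<And>r s. r \<in> R \<Longrightarrow> s \<in> R \<Longrightarrow> val_ge (r - s) 1 \<Longrightarrow> r = s"
    "finite residue_field \<Longrightarrow> finite R"
proof -
  define rep where "rep = inv_into val_ring residue_class"
  have rep: "rep X \<in> val_ring" "residue_class (rep X) = X" if "X \<in> residue_field" for X
    using that inv_into_into[of X residue_class val_ring] f_inv_into_f[of X residue_class val_ring]
    unfolding rep_def residue_field_def by blast+
  have inj: "inj_on rep residue_field"
    by (metis inj_on_inverseI rep(2))
  show ?thesis
  proof (rule that[of "rep ` residue_field"])
    show "\<exists>r\<in>rep ` residue_field. val_ge (x - r) 1" if "val_ge x 0" for x
      using that rep[of "residue_class x"]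
      by (intro bexI[of _ "rep (residue_class x)"])
        (auto simp: residue_field_def residue_class_eq_iff[symmetric])
    show "r = s" if "r \<in> rep ` residue_field" "s \<in> rep ` residue_field" "val_ge (r - s) 1" for r s
      using that rep(2) by (metis imageE residue_class_eq_iff)
  qed (use rep(1) card_image[OF inj] in auto)
qed

end

section \<open>Modules over the valuation ring, and lattices\<close>

text \<open>For \<open>n > 0\<close> the dimension formula provides a finite basis, and multiplication by the uniformizer
shrinks every lattice strictly.\<close>

locale nontrivial_symplectic_space = symplectic_space ord unif scale form n
  for ord :: "'k::field \<Rightarrow> int" and unif :: 'k
    and scale :: "'k \<Rightarrow> 'v::ab_group_add \<Rightarrow> 'v"
    and form :: "'v \<Rightarrow> 'v \<Rightarrow> 'k" and n :: nat +
  assumes n_pos: "n > 0"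
begin

definition submod :: "'v set \<Rightarrow> bool" where
  "submod N \<longleftrightarrow> 0 \<in> N \<and> (\<forall>x\<in>N. \<forall>y\<in>N. x + y \<in> N) \<and> (\<forall>c x. val_ge c 0 \<longrightarrow> x \<in> N \<longrightarrow> scale c x \<in> N)"

lemma submod_zero: "submod N \<Longrightarrow> 0 \<in> N"
  and submod_add: "submod N \<Longrightarrow> x \<in> N \<Longrightarrow> y \<in> N \<Longrightarrow> x + y \<in> N"
  and submod_scale: "submod N \<Longrightarrow> val_ge c 0 \<Longrightarrow> x \<in> N \<Longrightarrow> scale c x \<in> N"
  by (auto simp: submod_def)

lemma submod_minus: "submod N \<Longrightarrow> x \<in> N \<Longrightarrow> - x \<in> N"
  using submod_scale[of N "- 1" x] by simp

lemma submod_diff: "submod N \<Longrightarrow> x \<in> N \<Longrightarrow> y \<in> N \<Longrightarrow> x - y \<in> N"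
  using submod_add[of N x "- y"] submod_minus by simp

lemma submod_sum: "submod N \<Longrightarrow> (\<And>i. i \<in> I \<Longrightarrow> f i \<in> N) \<Longrightarrow> sum f I \<in> N"
  by (induction I rule: infinite_finite_induct) (auto intro: submod_add submod_zero)

lemma mem_O_span:
  "x \<in> O_span B \<longleftrightarrow> (\<exists>c. (\<forall>b\<in>B. val_ge (c b) 0) \<and> x = (\<Sum>b\<in>B. scale (c b) b))"
  by (auto simp: O_span_def)

lemma submod_O_span: "submod (O_span B)"
  unfolding submod_def
proof (intro conjI ballI allI impI)
  show "0 \<in> O_span B"
    unfolding O_span_def by (force intro: exI[of _ "\<lambda>_. 0"])
next
  fix x y assume "x \<in> O_span B" "y \<in> O_span B"
  then obtain c d where "\<forall>b\<in>B. val_ge (c b) 0" "x = (\<Sum>b\<in>B. scale (c b) b)"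
    and "\<forall>b\<in>B. val_ge (d b) 0" "y = (\<Sum>b\<in>B. scale (d b) b)"
    by (auto simp: O_span_def)
  then show "x + y \<in> O_span B"
    unfolding O_span_def
    by (intro CollectI exI[of _ "\<lambda>b. c b + d b"])
      (auto simp: sum.distrib scale_left_distrib val_ge_add)
next
  fix a x assume "val_ge a 0" "x \<in> O_span B"
  then obtain c where "\<forall>b\<in>B. val_ge (c b) 0" "x = (\<Sum>b\<in>B. scale (c b) b)"
    by (auto simp: O_span_def)
  then show "scale a x \<in> O_span B"
    using \<open>val_ge a 0\<close> unfolding O_span_def
    by (intro CollectI exI[of _ "\<lambda>b. a * c b"]) (auto simp: scale_sum_right val_ge_mult_left)
qed

lemma O_span_base: "finite B \<Longrightarrow> b \<in> B \<Longrightarrow> b \<in> O_span B"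
  unfolding O_span_def
  by (intro CollectI exI[of _ "\<lambda>x. if x = b then 1 else 0"])
    (auto simp: if_distrib[of "\<lambda>c. scale c _"] cong: if_cong)

lemma O_span_minimal: "submod N \<Longrightarrow> B \<subseteq> N \<Longrightarrow> O_span B \<subseteq> N"
  by (auto simp: O_span_def intro!: submod_sum submod_scale)

lemma mem_scale_image: "a \<noteq> 0 \<Longrightarrow> x \<in> scale a ` L \<longleftrightarrow> scale (inverse a) x \<in> L"
  by (metis (no_types, lifting) field_class.field_inverse image_iff nonzero_imp_inverse_nonzero
      right_inverse scale_one scale_scale)

lemma scale_image_scale_image: "scale a ` scale b ` L = scale (a * b) ` L"
  by (auto simp: image_image)

lemma submod_scale_image: "submod L \<Longrightarrow> submod (scale a ` L)"
  by (auto simp: submod_def scale_right_distrib[symmetric] intro!: imageI)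
    (metis image_eqI mult.commute scale_scale scale_zero_right)+

lemma scale_unif_image_subset: "submod L \<Longrightarrow> scale unif ` L \<subseteq> L"
  using val_ge_mono[OF val_ge_unif, of 0] by (auto intro: submod_scale)

lemma scale_image_unit:
  assumes "submod L" "a \<noteq> 0" "ord a = 0"
  shows "scale a ` L = L"
proof -
  have "val_ge a 0" "val_ge (inverse a) 0"
    using assms by (simp_all add: val_ge_def ord_inverse)
  then show ?thesis
    using assms by (auto simp: mem_scale_image intro: submod_scale)
qed

lemma ex_finite_basis: "\<exists>B. finite B \<and> independent B \<and> span B = UNIV"
proof -
  obtain B where B: "independent B" "span B = UNIV" "card B = dim UNIV"
    using basis_exists[of UNIV] by (metis UNIV_I subsetI subset_antisym)
  then have "finite B"
    using dim_UNIV n_pos by (metis card.infinite mult_is_0 neq0_conv zero_neq_numeral)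
  with B show ?thesis by blast
qed

definition fin_basis :: "'v set" where
  "fin_basis = (SOME B. finite B \<and> independent B \<and> span B = UNIV)"

lemma dim_space: "dim UNIV = 2 * n"
  by (rule dim_UNIV)

sublocale finite_dimensional_vector_space scale fin_basis
proof
  show "finite fin_basis" "independent fin_basis" "span fin_basis = UNIV"
    using someI_ex[OF ex_finite_basis] unfolding fin_basis_def by auto
qed

lemma card_of_basis: "independent B \<Longrightarrow> span B = UNIV \<Longrightarrow> card B = 2 * n"
  using dim_space dim_span_eq_card_independent[of B] by simp

lemma basis_of_card: "independent B \<Longrightarrow> card B = 2 * n \<Longrightarrow> span B = UNIV"
  using card_ge_dim_independent[of B UNIV] dim_space by auto

text \<open>Dividing a linear relation by a coefficient of least valuation makes all its coefficients
  integral and one of them 1.\<close>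

lemma dependent_imp_mem_O_span:
  assumes "finite B" "dependent B"
  obtains b where "b \<in> B" "b \<in> O_span (B - {b})"
proof -
  obtain u where u: "\<exists>v\<in>B. u v \<noteq> 0" "(\<Sum>v\<in>B. scale (u v) v) = 0"
    using assms dependent_finite by blast
  define Z where "Z = {v\<in>B. u v \<noteq> 0}"
  have Z: "finite Z" "Z \<noteq> {}" using u assms by (auto simp: Z_def)
  define b where "b = arg_min_on (\<lambda>v. ord (u v)) Z"
  have b: "b \<in> Z" "\<And>v. v \<in> Z \<Longrightarrow> ord (u b) \<le> ord (u v)"
    using arg_min_if_finite(1)[OF Z, of "\<lambda>v. ord (u v)"] arg_min_least[OF Z, of _ "\<lambda>v. ord (u v)"]
    by (simp_all add: b_def)
  define c where "c v = - (u v / u b)" for v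
  have bB: "b \<in> B" "u b \<noteq> 0" using b by (auto simp: Z_def)
  have c: "val_ge (c v) 0" if "v \<in> B" for v
    using b(2)[of v] that bB by (cases "u v = 0") (auto simp: Z_def c_def val_ge_def ord_divide)
  have "(\<Sum>v\<in>B - {b}. scale (u v) v) = - scale (u b) b"
    using u(2) bB assms(1) by (simp add: sum.remove eq_neg_iff_add_eq_0 add.commute)
  then have "scale (- inverse (u b)) (\<Sum>v\<in>B - {b}. scale (u v) v) = b"
    using bB by simp
  then have "b = (\<Sum>v\<in>B - {b}. scale (c v) v)"
    by (simp add: scale_sum_right c_def divide_inverse mult.commute)
  with c have "b \<in> O_span (B - {b})"
    unfolding O_span_def by auto
  with bB that show ?thesis by blast
qed

lemma O_independent_iff:
  assumes "finite B"
  shows "O_independent B \<longleftrightarrow> independent B"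
proof
  assume B: "O_independent B"
  show "independent B"
  proof
    assume "dependent B"
    then obtain b where b: "b \<in> B" "b \<in> O_span (B - {b})"
      using assms dependent_imp_mem_O_span by blast
    then obtain c where c: "\<forall>v\<in>B - {b}. val_ge (c v) 0" "b = (\<Sum>v\<in>B - {b}. scale (c v) v)"
      by (auto simp: O_span_def)
    define d where "d v = (if v = b then - 1 else c v)" for v
    have "(\<Sum>v\<in>B. scale (d v) v) = scale (d b) b + (\<Sum>v\<in>B - {b}. scale (d v) v)"
      using assms b by (simp add: sum.remove)
    also have "(\<Sum>v\<in>B - {b}. scale (d v) v) = (\<Sum>v\<in>B - {b}. scale (c v) v)"
      by (intro sum.cong) (auto simp: d_def)
    also note c(2)[symmetric]
    finally have "(\<Sum>v\<in>B. scale (d v) v) = 0" by (simp add: d_def)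
    moreover have "\<forall>v\<in>B. d v \<in> val_ring" using c(1) by (auto simp: d_def)
    ultimately have "d b = 0" using B b(1) by (auto simp: O_independent_def)
    then show False by (simp add: d_def)
  qed
next
  assume "independent B"
  then show "O_independent B"
    using assms by (auto simp: O_independent_def dependent_finite)
qed

lemma lattice_iff_basis:
  "lattice L \<longleftrightarrow> (\<exists>B. finite B \<and> independent B \<and> span B = UNIV \<and> L = O_span B)"
proof -
  have "card B = 2 * n \<and> O_independent B \<longleftrightarrow> independent B \<and> span B = UNIV" if "finite B" for B
    using O_independent_iff[OF that] basis_of_card[of B] card_of_basis[of B] by auto
  then show ?thesis unfolding lattice_def by (intro arg_cong[where f = Ex] ext) auto
qed

lemma lattice_basis:
  assumes "lattice L"
  obtains B where "finite B" "independent B" "span B = UNIV" "L = O_span B"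
  using assms lattice_iff_basis[of L] by auto

lemma lattice_submod: "lattice L \<Longrightarrow> submod L"
  by (auto simp: lattice_def submod_O_span)

text \<open>A finitely generated module over the valuation ring that spans the space is free: a minimal
  set of generators is independent.\<close>

lemma lattice_O_span:
  assumes "finite S" "span S = UNIV"
  shows "lattice (O_span S)"
proof -
  define Q where "Q = {B. B \<subseteq> S \<and> O_span B = O_span S}"
  have "finite Q" "S \<in> Q" using assms by (auto simp: Q_def)
  then obtain B where B: "B \<in> Q" "\<And>B'. B' \<in> Q \<Longrightarrow> B' \<subseteq> B \<Longrightarrow> B' = B"
    using finite_has_minimal[of Q] by (metis empty_iff)
  have fin: "finite B" using B assms by (auto simp: Q_def intro: finite_subset)
  have "independent B"
  proof
    assume "dependent B"
    then obtain b where b: "b \<in> B" "b \<in> O_span (B - {b})"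
      using fin dependent_imp_mem_O_span by blast
    then have "O_span B \<subseteq> O_span (B - {b})"
      using fin by (intro O_span_minimal submod_O_span) (auto intro: O_span_base)
    moreover have "O_span (B - {b}) \<subseteq> O_span B"
      using fin by (intro O_span_minimal submod_O_span) (auto intro: O_span_base)
    ultimately have "B - {b} \<in> Q" using B by (auto simp: Q_def)
    with B(2) b(1) show False by blast
  qed
  moreover have "span B = UNIV"
  proof -
    have "O_span B \<subseteq> span B"
      by (auto simp: O_span_def intro!: span_sum span_scale intro: span_base)
    moreover have "S \<subseteq> O_span B" using B(1) O_span_base[OF assms(1)] unfolding Q_def by blast
    ultimately have "span S \<subseteq> span B" by (meson order_trans span_minimal subspace_span)
    with assms show ?thesis by auto
  qed
  ultimately show ?thesis
    unfolding lattice_iff_basis using B(1) fin by (intro exI[of _ B]) (simp add: Q_def)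
qed

lemma basis_expansion:
  assumes "finite B" "span B = UNIV"
  obtains c where "x = (\<Sum>b\<in>B. scale (c b) b)"
proof -
  have "x \<in> range (\<lambda>u. \<Sum>b\<in>B. scale (u b) b)"
    using assms span_finite[of B] by simp
  then show ?thesis using that by blast
qed

lemma basis_unique:
  assumes "finite B" "independent B" "(\<Sum>b\<in>B. scale (c b) b) = (\<Sum>b\<in>B. scale (d b) b)" "b \<in> B"
  shows "c b = d b"
proof -
  have "(\<Sum>b\<in>B. scale (c b - d b) b) = 0"
    using assms(3) by (simp add: scale_left_diff_distrib sum_subtractf)
  then have "c b - d b = 0"
    by (rule independentD[OF assms(2,1) order_refl _ assms(4)])
  then show ?thesis by simp
qed

lemma lattice_scale_image:
  assumes "lattice L" "a \<noteq> 0"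
  shows "lattice (scale a ` L)"
proof -
  obtain B where B: "finite B" "span B = UNIV" "L = O_span B"
    by (rule lattice_basis[OF assms(1)])
  have "scale a ` L = O_span (scale a ` B)"
  proof
    show "scale a ` L \<subseteq> O_span (scale a ` B)"
    proof
      fix x assume "x \<in> scale a ` L"
      then obtain c where c: "\<forall>b\<in>B. val_ge (c b) 0" "x = (\<Sum>b\<in>B. scale (c b) (scale a b))"
        by (auto simp: B(3) O_span_def scale_sum_right mult.commute)
      have "scale (c b) (scale a b) \<in> O_span (scale a ` B)" if "b \<in> B" for b
        using that c(1) B(1) by (intro submod_scale[OF submod_O_span] O_span_base) auto
      then show "x \<in> O_span (scale a ` B)"
        unfolding c(2) by (intro submod_sum[OF submod_O_span])
    qed
    show "O_span (scale a ` B) \<subseteq> scale a ` L"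
      using B by (intro O_span_minimal submod_scale_image) (auto simp: submod_O_span O_span_base)
  qed
  moreover have "span (scale a ` B) = UNIV"
  proof -
    have "B \<subseteq> span (scale a ` B)"
    proof
      fix b assume "b \<in> B"
      then have "scale (inverse a) (scale a b) \<in> span (scale a ` B)"
        by (intro span_scale span_base imageI)
      then show "b \<in> span (scale a ` B)" using assms(2) by simp
    qed
    then have "span B \<subseteq> span (scale a ` B)" by (simp add: span_minimal)
    with B show ?thesis by auto
  qed
  ultimately show ?thesis using lattice_O_span[of "scale a ` B"] B by simp
qed

text \<open>A basis of \<open>L\<close> identifies \<open>L / \<pi>L\<close> with the \<open>2n\<close>-tuples over the residue field.\<close>

lemma lattice_coset_representatives:
  assumes "lattice L"
  obtains T where "finite T" "card T = card residue_field ^ (2 * n)" "T \<subseteq> L"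
    "\<And>x. x \<in> L \<Longrightarrow> \<exists>t\<in>T. x - t \<in> scale unif ` L"
    "\<And>s t. s \<in> T \<Longrightarrow> t \<in> T \<Longrightarrow> s - t \<in> scale unif ` L \<Longrightarrow> s = t"
proof -
  obtain B where B: "finite B" "independent B" "span B = UNIV" "L = O_span B"
    by (rule lattice_basis[OF assms])
  obtain R where R: "R \<subseteq> val_ring" "card R = card residue_field"
    "\<And>x. val_ge x 0 \<Longrightarrow> \<exists>r\<in>R. val_ge (x - r) 1"
    "\<And>r s. r \<in> R \<Longrightarrow> s \<in> R \<Longrightarrow> val_ge (r - s) 1 \<Longrightarrow> r = s" "finite R"
    using residue_representatives finite_residue_field by metis
  define h where "h f = (\<Sum>b\<in>B. scale (f b) b)" for f
  have unique: "f = g" if fg: "f \<in> B \<rightarrow>\<^sub>E R" "g \<in> B \<rightarrow>\<^sub>E R" "h f - h g \<in> scale unif ` L" for f g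
  proof
    fix b
    obtain d where d: "\<forall>b\<in>B. val_ge (d b) 0" "h f - h g = scale unif (\<Sum>b\<in>B. scale (d b) b)"
      using fg(3) B(4) by (auto simp: O_span_def)
    then have eq: "(\<Sum>b\<in>B. scale (f b - g b) b) = (\<Sum>b\<in>B. scale (unif * d b) b)"
      by (simp add: h_def scale_left_diff_distrib sum_subtractf scale_sum_right)
    show "f b = g b"
    proof (cases "b \<in> B")
      case True
      then have "f b - g b = unif * d b" using basis_unique[OF B(1,2) eq] by simp
      then have "val_ge (f b - g b) 1" using val_ge_mult[of unif 1 "d b" 0] d True by simp
      then show ?thesis using R(4) fg True by auto
    qed (simp add: PiE_arb[OF fg(1)] PiE_arb[OF fg(2)])
  qed
  have inj: "inj_on h (B \<rightarrow>\<^sub>E R)"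
    using unique submod_zero[OF submod_scale_image[OF lattice_submod[OF assms]]]
    by (intro inj_onI) (metis diff_self)
  show ?thesis
  proof (rule that[of "h ` (B \<rightarrow>\<^sub>E R)"])
    show "finite (h ` (B \<rightarrow>\<^sub>E R))" using B R by (auto intro: finite_PiE)
    show "card (h ` (B \<rightarrow>\<^sub>E R)) = card residue_field ^ (2 * n)"
      using card_image[OF inj] card_PiE[of B "\<lambda>_. R"] B R card_of_basis by simp
    show "h ` (B \<rightarrow>\<^sub>E R) \<subseteq> L"
      using R(1) unfolding h_def B(4) O_span_def by (auto simp: PiE_def Pi_def subset_iff)
    show "\<exists>t\<in>h ` (B \<rightarrow>\<^sub>E R). x - t \<in> scale unif ` L" if x: "x \<in> L" for x
    proof -
      obtain c where c: "\<forall>b\<in>B. val_ge (c b) 0" "x = (\<Sum>b\<in>B. scale (c b) b)"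
        using x[unfolded B(4) mem_O_span] by blast
      then obtain r where r: "\<forall>b\<in>B. r b \<in> R \<and> val_ge (c b - r b) 1"
        using bchoice[of B "\<lambda>b r. r \<in> R \<and> val_ge (c b - r) 1"] R(3) by blast
      define f where "f = restrict r B"
      have f: "f \<in> B \<rightarrow>\<^sub>E R" "\<And>b. b \<in> B \<Longrightarrow> val_ge (c b - f b) 1"
        using r by (auto simp: f_def)
      have "(\<Sum>b\<in>B. scale ((c b - f b) / unif) b) \<in> L"
        unfolding B(4) O_span_def using f(2) val_ge_divide_unif[of _ 1] by force
      moreover have "x - h f = scale unif (\<Sum>b\<in>B. scale ((c b - f b) / unif) b)"
        using unif_nonzero
        by (simp add: c(2) h_def scale_sum_right scale_left_diff_distrib sum_subtractf)
      ultimately show ?thesis using f(1) by blast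
    qed
  qed (use unique in blast)
qed

text \<open>A module between \<open>\<pi>L\<close> and \<open>L\<close> is generated by \<open>\<pi>L\<close> and coset representatives.\<close>

lemma lattice_sandwich:
  assumes "lattice L" "submod N" "scale unif ` L \<subseteq> N" "N \<subseteq> L"
  shows "lattice N"
proof -
  obtain T where T: "finite T" "T \<subseteq> L" "\<And>x. x \<in> L \<Longrightarrow> \<exists>t\<in>T. x - t \<in> scale unif ` L"
    using lattice_coset_representatives[OF assms(1)] by metis
  have "lattice (scale unif ` L)" by (simp add: assms(1) lattice_scale_image unif_nonzero)
  then obtain B where B: "finite B" "span B = UNIV" "scale unif ` L = O_span B"
    by (rule lattice_basis)
  define S where "S = B \<union> (N \<inter> T)"
  have fin: "finite S" using B T by (simp add: S_def)
  have "O_span S \<subseteq> N"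
    using assms(2,3) B O_span_base by (intro O_span_minimal) (auto simp: S_def)
  moreover have "N \<subseteq> O_span S"
  proof
    fix x assume x: "x \<in> N"
    then obtain t where t: "t \<in> T" "x - t \<in> scale unif ` L" using T assms by blast
    have "t = x - (x - t)" by simp
    then have "t \<in> N" using x t assms submod_diff by (metis subsetD)
    moreover have "O_span B \<subseteq> O_span S"
      using fin by (intro O_span_minimal submod_O_span) (auto simp: S_def intro: O_span_base)
    ultimately have "(x - t) + t \<in> O_span S"
      using t B fin by (intro submod_add[OF submod_O_span]) (auto simp: S_def intro: O_span_base)
    then show "x \<in> O_span S" by simp
  qed
  moreover have "span S = UNIV"
    using B(2) span_mono[of B S] by (auto simp: S_def)
  ultimately show ?thesis using lattice_O_span[OF fin] by (metis subset_antisym)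
qed

text \<open>Such a module is a union of cosets of \<open>\<pi>L\<close>, and there are finitely many of these. This bounds the
length of chains, so that maximal chains and maximal isotropic modules exist.\<close>

lemma finite_submods_between:
  assumes "lattice L"
  shows "finite {N. submod N \<and> scale unif ` L \<subseteq> N \<and> N \<subseteq> L}" (is "finite ?Q")
proof -
  obtain T where T: "finite T" "T \<subseteq> L" "\<And>x. x \<in> L \<Longrightarrow> \<exists>t\<in>T. x - t \<in> scale unif ` L"
    using lattice_coset_representatives[OF assms] by metis
  have sub: "N \<subseteq> N'" if N: "N \<in> ?Q" "N' \<in> ?Q" "N \<inter> T = N' \<inter> T" for N N'
  proof
    fix x assume x: "x \<in> N"
    then obtain t where t: "t \<in> T" "x - t \<in> scale unif ` L" using T(3)[of x] N(1) by blast
    have "t = x - (x - t)" by simp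
    then have "t \<in> N" using x t N submod_diff by (metis (lifting) mem_Collect_eq subsetD)
    then have "t \<in> N'" using t N by blast
    then have "(x - t) + t \<in> N'" using t N by (blast intro: submod_add)
    then show "x \<in> N'" by simp
  qed
  have "inj_on (\<lambda>N. N \<inter> T) ?Q"
    using sub by (intro inj_onI subset_antisym) simp_all
  moreover have "finite ((\<lambda>N. N \<inter> T) ` ?Q)"
    using T(1) by (rule finite_subset[rotated, OF finite_Pow_iff[THEN iffD2]]) auto
  ultimately show ?thesis using finite_imageD by blast
qed

text \<open>A basis vector of \<open>L\<close> in \<open>\<pi>L\<close> would have a coordinate of positive valuation equal to 1.\<close>

lemma lattice_not_subset_unif:
  assumes "lattice L"
  shows "\<not> L \<subseteq> scale unif ` L"
proof
  assume sub: "L \<subseteq> scale unif ` L"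
  obtain B where B: "finite B" "independent B" "span B = UNIV" "L = O_span B"
    by (rule lattice_basis[OF assms])
  then have "B \<noteq> {}" using card_of_basis n_pos by fastforce
  then obtain b where b: "b \<in> B" by blast
  then have "b \<in> scale unif ` L" using sub B O_span_base by blast
  then obtain d where d: "\<forall>b\<in>B. val_ge (d b) 0" "b = scale unif (\<Sum>b\<in>B. scale (d b) b)"
    using B(4) by (auto simp: O_span_def)
  have "(\<Sum>v\<in>B. scale (if v = b then 1 else 0) v) = b"
    using B(1) b by (simp add: if_distrib[of "\<lambda>c. scale c _"] cong: if_cong)
  also have "\<dots> = (\<Sum>b\<in>B. scale (unif * d b) b)"
    by (subst d(2)) (simp add: scale_sum_right)
  finally have "1 = unif * d b" using basis_unique[OF B(1,2) _ b, of "\<lambda>v. if v = b then 1 else 0" "\<lambda>v. unif * d v"] by simp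
  moreover have "val_ge (unif * d b) 1" using val_ge_mult[of unif 1 "d b" 0] d b by simp
  ultimately show False by (metis val_ge_def ord_one not_one_le_zero zero_neq_one)
qed

end

definition comparable :: "'a set \<Rightarrow> 'a set \<Rightarrow> bool" where
  "comparable A B \<longleftrightarrow> A \<subseteq> B \<or> B \<subseteq> A"

context nontrivial_symplectic_space
begin

section \<open>Dual lattices\<close>

lemma form_add_left: "form (x + y) z = form x z + form y z"
  and form_add_right: "form z (x + y) = form z x + form z y"
  and form_scale_left: "form (scale c x) z = c * form x z"
  and form_scale_right: "form z (scale c x) = c * form z x"
  using module_hom.add[OF form_linear_left[of z, THEN Vector_Spaces.linear.axioms(3)], of x y]
    module_hom.add[OF form_linear_right[of z, THEN Vector_Spaces.linear.axioms(3)], of x y]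
    module_hom.scale[OF form_linear_left[of z, THEN Vector_Spaces.linear.axioms(3)], of c x]
    module_hom.scale[OF form_linear_right[of z, THEN Vector_Spaces.linear.axioms(3)], of c x]
  by simp_all

lemma form_zero_left [simp]: "form 0 z = 0"
  and form_zero_right [simp]: "form z 0 = 0"
  using form_scale_left[of 0 0 z] form_scale_right[of z 0 0] by simp_all

lemma form_minus_left: "form (- x) z = - form x z"
  and form_minus_right: "form z (- x) = - form z x"
  using form_scale_left[of "- 1" x z] form_scale_right[of z "- 1" x] by simp_all

lemma form_diff_left: "form (x - y) z = form x z - form y z"
  and form_diff_right: "form z (x - y) = form z x - form z y"
  using form_add_left[of x "- y" z] form_add_right[of z x "- y"]
  by (simp_all add: form_minus_left form_minus_right)

lemma form_sum_left: "form (sum f I) z = (\<Sum>i\<in>I. form (f i) z)"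
  by (induction I rule: infinite_finite_induct) (simp_all add: form_add_left)

lemma form_commute: "form x y = - form y x"
  using form_alternating[of "x + y"] form_alternating[of x] form_alternating[of y]
  by (simp add: form_add_left form_add_right eq_neg_iff_add_eq_0 add.commute)

lemmas form_simps = form_add_left form_add_right form_scale_left form_scale_right
  form_minus_left form_minus_right form_diff_left form_diff_right form_alternating

lemma val_ge_form_commute: "val_ge (form x y) j \<longleftrightarrow> val_ge (form y x) j"
  using form_commute[of x y] by simp

definition dual :: "int \<Rightarrow> 'v set \<Rightarrow> 'v set" where
  "dual j A = {x. \<forall>y\<in>A. val_ge (form x y) j}"

lemma dualI: "(\<And>y. y \<in> A \<Longrightarrow> val_ge (form x y) j) \<Longrightarrow> x \<in> dual j A"
  and dualD: "x \<in> dual j A \<Longrightarrow> y \<in> A \<Longrightarrow> val_ge (form x y) j"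
  by (auto simp: dual_def)

lemma submod_dual: "submod (dual j A)"
  by (auto simp: submod_def dual_def form_simps val_ge_add val_ge_mult_left)

lemma dual_mono: "A \<subseteq> B \<Longrightarrow> dual j B \<subseteq> dual j A"
  by (auto simp: dual_def)

lemma dual_level_mono: "i \<le> j \<Longrightarrow> dual j A \<subseteq> dual i A"
  by (auto simp: dual_def intro: val_ge_mono)

lemma subset_dual_commute: "A \<subseteq> dual j B \<longleftrightarrow> B \<subseteq> dual j A"
  unfolding dual_def using val_ge_form_commute by blast

lemma scale_dual:
  assumes "a \<noteq> 0"
  shows "scale a ` dual j A = dual (j + ord a) A"
proof -
  have "val_ge (form (scale (inverse a) x) y) j \<longleftrightarrow> val_ge (form x y) (j + ord a)" for x y
    using assms val_ge_cancel[of "inverse a" "form x y" j] by (simp add: form_scale_left ord_inverse)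
  then show ?thesis unfolding set_eq_iff mem_scale_image[OF assms] by (simp add: dual_def)
qed

lemma dual_scale: "a \<noteq> 0 \<Longrightarrow> dual j (scale a ` A) = dual (j - ord a) A"
  by (auto simp: dual_def form_scale_right val_ge_cancel)

lemma scale_unif_dual: "scale unif ` dual j A = dual (j + 1) A"
  using scale_dual[OF unif_nonzero] by (simp add: ord_unif)

lemma dual_scale_unif: "dual j (scale unif ` A) = dual (j - 1) A"
  using dual_scale[OF unif_nonzero] by (simp add: ord_unif)

text \<open>Non-degeneracy makes \<open>x \<mapsto> \<Sum>b\<in>B. \<langle>b, x\<rangle> b\<close> injective, hence surjective, and a preimage of
  \<open>b\<close> is the element dual to \<open>b\<close>.\<close>

lemma ex_dual_vector:
  assumes "finite B" "independent B" "span B = UNIV" "b \<in> B"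
  obtains w where "\<And>v. v \<in> B \<Longrightarrow> form v w = (if v = b then 1 else 0)"
proof -
  define T where "T x = (\<Sum>v\<in>B. scale (form v x) v)" for x
  have lin: "Vector_Spaces.linear scale scale T"
    by unfold_locales
      (simp_all add: T_def form_simps scale_left_distrib sum.distrib scale_sum_right)
  have "x = 0" if "T x = 0" for x
  proof -
    have zero: "form v x = 0" if "v \<in> B" for v
      using independentD[OF assms(2,1) order_refl _ that, of "\<lambda>v. form v x"] \<open>T x = 0\<close>
      by (simp add: T_def)
    have "subspace {y. form y x = 0}" by (auto simp: subspace_def form_simps)
    then have "span B \<subseteq> {y. form y x = 0}" using zero by (intro span_minimal) auto
    then have "form x y = 0" for y using assms(3) form_commute[of x y] by auto
    then show "x = 0" by (rule form_nondegenerate)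
  qed
  moreover have "T (x - y) = T x - T y" for x y
    by (simp add: T_def form_simps scale_left_diff_distrib sum_subtractf)
  ultimately have "inj T" by (metis injI eq_iff_diff_eq_0)
  then have "surj T" using lin linear_inj_imp_surj by blast
  then obtain w where "T w = b" by (metis surjD)
  then have "(\<Sum>v\<in>B. scale (form v w) v) = (\<Sum>v\<in>B. scale (if v = b then 1 else 0) v)"
    using assms(1,4) by (simp add: T_def if_distrib[of "\<lambda>c. scale c _"] cong: if_cong)
  then have "form v w = (if v = b then 1 else 0)" if "v \<in> B" for v
    by (rule basis_unique[OF assms(1,2) _ that])
  then show ?thesis by (rule that)
qed

text \<open>A vector outside \<open>A\<close> has a non-integral coordinate in a basis of \<open>A\<close>. The corresponding dual vector,
scaled by \<open>\<pi>\<^sup>j\<close>, lies in \<open>dual j A\<close> and detects it.\<close>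

lemma dual_dual:
  assumes "lattice A"
  shows "dual j (dual j A) = A"
proof
  show "A \<subseteq> dual j (dual j A)" by (subst subset_dual_commute) simp
  obtain B where B: "finite B" "independent B" "span B = UNIV" "A = O_span B"
    by (rule lattice_basis[OF assms])
  show "dual j (dual j A) \<subseteq> A"
  proof
    fix x assume x: "x \<in> dual j (dual j A)"
    obtain c where c: "x = (\<Sum>b\<in>B. scale (c b) b)" by (rule basis_expansion[OF B(1,3)])
    have "val_ge (c b) 0" if b: "b \<in> B" for b
    proof -
      obtain w where w: "\<And>v. v \<in> B \<Longrightarrow> form v w = (if v = b then 1 else 0)"
        using ex_dual_vector[OF B(1-3) b] by blast
      have coord: "form (\<Sum>b\<in>B. scale (d b) b) w = d b" for d
        proof -
          have "form (\<Sum>b\<in>B. scale (d b) b) w = (\<Sum>v\<in>B. if v = b then d v else 0)"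
            unfolding form_sum_left by (intro sum.cong refl) (simp add: form_scale_left w)
          then show ?thesis using B(1) b by simp
        qed
        have "form (scale (unif powi j) w) y = - (unif powi j * form y w)" for y
        using form_commute[of w y] by (simp add: form_scale_left)
      moreover have "val_ge (form y w) 0" if "y \<in> A" for y
      proof -
        obtain d where "\<forall>b\<in>B. val_ge (d b) 0" "y = (\<Sum>b\<in>B. scale (d b) b)"
          using \<open>y \<in> A\<close>[unfolded B(4) mem_O_span] by blast
        then show ?thesis using coord b by simp
      qed
      ultimately have "scale (unif powi j) w \<in> dual j A"
        by (auto intro!: dualI simp: val_ge_cancel unif_nonzero)
      then have "val_ge (form x (scale (unif powi j) w)) j" using x by (rule dualD[rotated])
      then show ?thesis by (simp add: form_scale_right val_ge_cancel unif_nonzero c coord)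
    qed
    then show "x \<in> A" unfolding B(4) mem_O_span using c by blast
  qed
qed

lemma lattice_absorbs:
  assumes "lattice L"
  shows "\<exists>k. scale (unif ^ k) x \<in> L"
proof -
  obtain B where B: "finite B" "span B = UNIV" "L = O_span B"
    by (rule lattice_basis[OF assms])
  have L: "submod L" by (rule lattice_submod[OF assms])
  have pow: "val_ge (unif ^ k) 0" for k
    by (simp add: val_ge_def ord_unif_power)
  have more: "scale (unif ^ (l + k)) x \<in> L" if "scale (unif ^ k) x \<in> L" for k l x
    using submod_scale[OF L pow[of l] that] by (simp add: power_add)
  have "subspace {x. \<exists>k. scale (unif ^ k) x \<in> L}"
    unfolding subspace_def
  proof (intro conjI allI ballI)
    show "0 \<in> {x. \<exists>k. scale (unif ^ k) x \<in> L}" using submod_zero[OF L] by simp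
  next
    fix x y assume "x \<in> {x. \<exists>k. scale (unif ^ k) x \<in> L}" "y \<in> {x. \<exists>k. scale (unif ^ k) x \<in> L}"
    then obtain k l where "scale (unif ^ k) x \<in> L" "scale (unif ^ l) y \<in> L" by blast
    then have "scale (unif ^ (l + k)) (x + y) \<in> L"
      using submod_add[OF L more[of k x l] more[of l y k]] by (simp add: scale_right_distrib add.commute)
    then show "x + y \<in> {x. \<exists>k. scale (unif ^ k) x \<in> L}" by blast
  next
    fix c x assume "x \<in> {x. \<exists>k. scale (unif ^ k) x \<in> L}"
    then obtain k where k: "scale (unif ^ k) x \<in> L" by blast
    define l where "l = nat (- ord c)"
    have "val_ge (unif ^ l * c) 0"
    proof (cases "c = 0")
      case False
      then show ?thesis
        by (simp add: val_ge_def ord_mult unif_nonzero ord_unif_power l_def)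
    qed simp
    then have "scale (unif ^ (k + l)) (scale c x) \<in> L"
      using submod_scale[OF L _ k, of "unif ^ l * c"] by (simp add: power_add mult_ac)
    then show "scale c x \<in> {x. \<exists>k. scale (unif ^ k) x \<in> L}" by blast
  qed
  moreover have "B \<subseteq> {x. \<exists>k. scale (unif ^ k) x \<in> L}"
    using O_span_base[OF B(1)] B(3) by (auto intro: exI[of _ 0])
  ultimately show ?thesis using span_minimal[of B] B(2) by blast
qed

lemma add_image_submod: "submod N \<Longrightarrow> y \<in> N \<Longrightarrow> (+) y ` N = N"
  by (auto intro: submod_add) (metis add_diff_cancel_left' diff_add_cancel image_eqI submod_diff add.commute)

text \<open>Non-degeneracy modulo \<open>\<pi>\<close> is self-duality. If \<open>x\<close> pairs integrally with \<open>L\<close> but the least \<open>k\<close> with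
\<open>\<pi>\<^sup>kx \<in> L\<close> were positive, then \<open>\<pi>\<^sup>kx\<close> would represent an element of the radical of the induced form,
so it would lie in \<open>\<pi>L\<close>, contrary to minimality of \<open>k\<close>. Conversely an element of the radical is
represented by some \<open>y \<in> dual 1 L = \<pi> dual 0 L = \<pi>L\<close>.\<close>

lemma primitive_iff_self_dual: "primitive L \<longleftrightarrow> lattice L \<and> dual 0 L = L"
proof (cases "lattice L")
  case lat: True
  note L = lattice_submod[OF lat]
  note piL = submod_scale_image[OF L, of unif]
  show ?thesis
  proof
    assume prim: "primitive L"
    then have "L \<subseteq> dual 0 L" by (auto simp: primitive_def dual_def)
    moreover have "x \<in> L" if x: "x \<in> dual 0 L" for x
    proof -
      define k where "k = (LEAST k. scale (unif ^ k) x \<in> L)"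
      have k: "scale (unif ^ k) x \<in> L"
        unfolding k_def using lattice_absorbs[OF lat] by (rule LeastI_ex)
      show "x \<in> L"
      proof (cases k)
        case 0
        with k show ?thesis by simp
      next
        case (Suc k')
        define y where "y = scale (unif ^ k) x"
        have y: "y \<in> dual 1 L" 
        proof (rule dualI)
          fix z assume "z \<in> L"
          then have "val_ge (form x z) 0" using x by (rule dualD[rotated])
          moreover have "val_ge (unif ^ k) 1"
            using Suc by (simp add: val_ge_def ord_unif_power del: power_Suc)
          ultimately show "val_ge (form y z) 1"
            using val_ge_mult[of "unif ^ k" 1 _ 0] by (simp add: y_def form_scale_left)
        qed
        have "induced_form ((+) y ` scale unif ` L) Y = max_ideal" if Y: "Y \<in> reduction L" for Y
        proof -
          obtain z where z: "z \<in> L" "Y = (+) z ` scale unif ` L"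
            using Y by (auto simp: reduction_def)
          have "residue_class (form a b) = max_ideal"
            if ab: "a \<in> (+) y ` scale unif ` L" "b \<in> Y" for a b
          proof -
            obtain l where l: "l \<in> L" "a = y + scale unif l" using ab by auto
            have b: "b \<in> L"
              using ab z scale_unif_image_subset[OF L] by (auto intro: submod_add[OF L])
            have "val_ge (form y b) 1" by (rule dualD[OF y b])
            moreover have "val_ge (form l b) 0"
              using prim l b by (auto simp: primitive_def)
            ultimately have "val_ge (form a b) 1"
              using val_ge_mult[of unif 1 "form l b" 0] by (simp add: l form_simps val_ge_add)
            then have "residue_class (form a b) = residue_class 0" by (simp add: residue_class_eq_iff)
            also have "\<dots> = max_ideal" by (auto simp: mem_residue_class)
            finally show ?thesis .
          qed
          moreover have "Y \<noteq> {}" "(+) y ` scale unif ` L \<noteq> {}"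
            using z submod_zero[OF L] by auto
          ultimately show ?thesis unfolding induced_form_def by auto
        qed
        moreover have "(+) y ` scale unif ` L \<in> reduction L"
          unfolding reduction_def by (rule image_eqI[OF refl]) (use k in \<open>simp add: y_def\<close>)
        ultimately have "(+) y ` scale unif ` L = scale unif ` L"
          using prim unfolding primitive_def by blast
        moreover have "y + 0 \<in> (+) y ` scale unif ` L" using submod_zero[OF piL] by blast
        ultimately have "y \<in> scale unif ` L" by simp
        then have "scale (inverse unif) y \<in> L" by (simp add: mem_scale_image unif_nonzero)
        then have "scale (unif ^ k') x \<in> L" by (simp add: y_def Suc unif_nonzero mult.assoc[symmetric])
        then have "k \<le> k'" unfolding k_def by (rule Least_le)
        with Suc show ?thesis by simp
      qed
    qed
    ultimately show "lattice L \<and> dual 0 L = L" using lat by blast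
  next
    assume "lattice L \<and> dual 0 L = L"
    then have sd: "dual 0 L = L" by simp
    show "primitive L"
      unfolding primitive_def
    proof (intro conjI ballI impI)
      fix X assume "X \<in> reduction L" and X: "\<forall>Y\<in>reduction L. induced_form X Y = max_ideal"
      then obtain y where y: "y \<in> L" "X = (+) y ` scale unif ` L"
        by (auto simp: reduction_def)
      have self: "z \<in> (+) z ` scale unif ` L" for z
        using submod_zero[OF piL] by (metis add.right_neutral imageI)
      have "y \<in> dual 1 L"
      proof (rule dualI)
        fix z assume "z \<in> L"
        then have "induced_form X ((+) z ` scale unif ` L) = max_ideal"
          using X by (auto simp: reduction_def)
        moreover have "form y z \<in> residue_class (form y z)" by (simp add: mem_residue_class)
        ultimately have "form y z \<in> max_ideal"
          using self[of y] self[of z] y(2) unfolding induced_form_def by blast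
        then show "val_ge (form y z) 1" by simp
      qed
      also have "dual 1 L = scale unif ` L" using scale_unif_dual[of 0 L] sd by simp
      finally show "X = scale unif ` L" using y(2) add_image_submod[OF piL] by simp
    qed (use lat dualD[of _ 0 L, unfolded sd] in auto)
  qed
qed (simp add: primitive_def)

definition adjoin :: "'v set \<Rightarrow> 'v \<Rightarrow> 'v set" where
  "adjoin A x = {a + scale c x | a c. a \<in> A \<and> val_ge c 0}"

lemma adjoinI: "a \<in> A \<Longrightarrow> val_ge c 0 \<Longrightarrow> a + scale c x \<in> adjoin A x"
  by (auto simp: adjoin_def)

lemma subset_adjoin: "A \<subseteq> adjoin A x"
  using adjoinI[of _ A 0 x] by auto

lemma mem_adjoin: "submod A \<Longrightarrow> x \<in> adjoin A x"
  using adjoinI[of 0 A 1 x] by (simp add: submod_zero)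

lemma submod_adjoin:
  assumes "submod A"
  shows "submod (adjoin A x)"
  unfolding submod_def
proof (intro conjI ballI allI impI)
  show "0 \<in> adjoin A x" using subset_adjoin submod_zero[OF assms] by blast
next
  fix y z assume "y \<in> adjoin A x" "z \<in> adjoin A x"
  then obtain a c b d where "y = a + scale c x" "z = b + scale d x" "a \<in> A" "b \<in> A"
      "val_ge c 0" "val_ge d 0"
    by (auto simp: adjoin_def)
  then show "y + z \<in> adjoin A x"
    using adjoinI[of "a + b" A "c + d" x] assms
    by (simp add: scale_left_distrib submod_add val_ge_add algebra_simps)
next
  fix e y assume "val_ge e 0" "y \<in> adjoin A x"
  then obtain a c where "y = a + scale c x" "a \<in> A" "val_ge c 0"
    by (auto simp: adjoin_def)
  then show "scale e y \<in> adjoin A x"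
    using adjoinI[of "scale e a" A "e * c" x] assms \<open>val_ge e 0\<close>
    by (simp add: scale_right_distrib submod_scale val_ge_mult_left)
qed

lemma adjoin_subset: "submod N \<Longrightarrow> A \<subseteq> N \<Longrightarrow> x \<in> N \<Longrightarrow> adjoin A x \<subseteq> N"
  by (auto simp: adjoin_def intro!: submod_add submod_scale)

lemma adjoin_isotropic:
  assumes "A \<subseteq> dual j A" "x \<in> dual j A"
  shows "adjoin A x \<subseteq> dual j (adjoin A x)"
proof (intro subsetI dualI)
  fix y z assume "y \<in> adjoin A x" "z \<in> adjoin A x"
  then obtain a c b d where "y = a + scale c x" "z = b + scale d x" "a \<in> A" "b \<in> A"
      "val_ge c 0" "val_ge d 0"
    by (auto simp: adjoin_def)
  moreover from this have "val_ge (form a b) j" "val_ge (form x b) j" "val_ge (form a x) j"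
    using assms dualD val_ge_form_commute by blast+
  ultimately show "val_ge (form y z) j"
    by (simp add: form_simps val_ge_add val_ge_mult_left)
qed

section \<open>The building as a poset of lattices\<close>

text \<open>The normalised representatives of the vertices. If \<open>G\<close> is a primitive lattice with \<open>\<pi>G \<subseteq> A \<subseteq> G\<close> and
\<open>A / \<pi>G\<close> is totally isotropic in \<open>G / \<pi>G\<close>, then both inclusions hold, and every vertex lattice arises
in this way. Leaving \<open>G\<close> out makes the symmetry under duality visible.\<close>

definition vertex_lattices :: "'v set set" where
  "vertex_lattices = {A. lattice A \<and> dual 2 A \<subseteq> A \<and> A \<subseteq> dual 1 A}"

lemma scale_unif_subset: "scale unif ` A \<subseteq> B \<longleftrightarrow> A \<subseteq> scale (inverse unif) ` B"
  using unif_nonzero by (auto simp: mem_scale_image image_subset_iff)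

text \<open>The form induces a non-degenerate alternating form on \<open>\<pi>\<^sup>-\<^sup>1A / dual 1 A\<close> with values in \<open>K / O\<close>. A maximal
isotropic module is its own orthogonal complement: an alternating form allows every vector of the
complement to be adjoined.\<close>

lemma exists_self_dual:
  assumes A: "A \<in> vertex_lattices"
  obtains G where "lattice G" "dual 0 G = G" "dual 1 A \<subseteq> G" "scale unif ` G \<subseteq> A"
proof -
  define K where "K = scale (inverse unif) ` A"
  have lat: "lattice A" "dual 2 A \<subseteq> A" "A \<subseteq> dual 1 A" using A by (auto simp: vertex_lattices_def)
  have K: "lattice K" "scale unif ` K = A"
    using lat unif_nonzero by (simp_all add: K_def lattice_scale_image scale_image_scale_image)
  have DK: "dual 1 A \<subseteq> K"
    using lat(2) scale_unif_dual[of 1 A] by (simp add: K_def scale_unif_subset[symmetric])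
  have dualK: "K = dual 0 (dual 1 A)"
    using scale_unif_dual[of 0 "dual 1 A"] dual_dual[OF lat(1), of 1] unif_nonzero
    by (metis (no_types, lifting) K_def scale_image_scale_image left_inverse image_cong image_ident scale_one add_0)
  \<comment> \<open>isotropic modules between \<open>dual 1 A\<close> and \<open>\<pi>\<^sup>-\<^sup>1A\<close>\<close>
  define Q where "Q = {G. submod G \<and> dual 1 A \<subseteq> G \<and> G \<subseteq> K \<and> G \<subseteq> dual 0 G}"
  have "Q \<subseteq> {N. submod N \<and> scale unif ` K \<subseteq> N \<and> N \<subseteq> K}"
    using lat(3) K(2) by (auto simp: Q_def)
  then have "finite Q" using finite_submods_between[OF K(1)] finite_subset by blast
  moreover have "dual 1 A \<in> Q" using DK dualK by (simp add: Q_def submod_dual)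
  ultimately obtain G where G: "G \<in> Q" "\<And>H. H \<in> Q \<Longrightarrow> G \<subseteq> H \<Longrightarrow> G = H"
    using finite_has_maximal[of Q] by (metis empty_iff)
  then have G': "submod G" "dual 1 A \<subseteq> G" "G \<subseteq> K" "G \<subseteq> dual 0 G" by (auto simp: Q_def)
  have "dual 0 G \<subseteq> G"
  proof
    fix x assume x: "x \<in> dual 0 G"
    have "dual 0 G \<subseteq> K" using dual_mono[OF G'(2)] dualK by simp
    then have "adjoin G x \<subseteq> K"
      using x G' lattice_submod[OF K(1)] by (intro adjoin_subset) auto
    then have "adjoin G x \<in> Q"
      using G' x subset_adjoin[of G x] adjoin_isotropic[OF G'(4) x] submod_adjoin[OF G'(1)]
      by (auto simp: Q_def)
    then show "x \<in> G" using G(2)[of "adjoin G x"] subset_adjoin mem_adjoin[OF G'(1), of x] by blast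
  qed
  moreover have "lattice G"
    using lat(3) K(2) G' by (intro lattice_sandwich[OF K(1)]) auto
  moreover have "scale unif ` G \<subseteq> A" using G'(3) K(2) by blast
  ultimately show ?thesis using that G' by blast
qed

text \<open>This turns the description of vertices by a primitive lattice \<open>G\<close> into the one without it.\<close>

lemma mem_vertex_latticesI:
  assumes "lattice A" "A \<subseteq> dual 1 A" "dual 0 G = G" "scale unif ` G \<subseteq> A"
  shows "A \<in> vertex_lattices"
proof -
  have "dual 2 A \<subseteq> dual 2 (scale unif ` G)" by (rule dual_mono[OF assms(4)])
  also have "\<dots> = scale unif ` G" 
    using scale_unif_dual[of 0 G] assms(3) dual_scale_unif[of 2 G] dual_scale_unif[of 1 G] by simp
  finally show ?thesis using assms by (auto simp: vertex_lattices_def)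
qed

lemma form_in_max_ideal_iff: "form_in_max_ideal A \<longleftrightarrow> A \<subseteq> dual 1 A"
  by (auto simp: form_in_max_ideal_def dual_def)

lemma vertex_lattice_submod: "A \<in> vertex_lattices \<Longrightarrow> submod A"
  by (auto simp: vertex_lattices_def lattice_submod)

lemma vertices_eq: "vertices = homothety_class ` vertex_lattices"
proof
  show "vertices \<subseteq> homothety_class ` vertex_lattices"
    unfolding vertices_def
    by (auto simp: primitive_iff_self_dual form_in_max_ideal_iff intro: mem_vertex_latticesI)
  show "homothety_class ` vertex_lattices \<subseteq> vertices"
  proof
    fix t assume "t \<in> homothety_class ` vertex_lattices"
    then obtain A where A: "A \<in> vertex_lattices" "t = homothety_class A" by blast
    then have A': "lattice A" "A \<subseteq> dual 1 A" by (auto simp: vertex_lattices_def)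
    obtain G where "lattice G" "dual 0 G = G" "dual 1 A \<subseteq> G" "scale unif ` G \<subseteq> A"
      by (rule exists_self_dual[OF A(1)])
    then show "t \<in> vertices"
      using A A' unfolding vertices_def primitive_iff_self_dual form_in_max_ideal_iff by blast
  qed
qed

text \<open>Scaling by \<open>a\<close> moves the levels of both duality conditions by \<open>2 ord a\<close>. Unless \<open>ord a = 0\<close>, the
conditions for \<open>A\<close> and \<open>a A\<close> together force \<open>A \<subseteq> \<pi>A\<close>.\<close>

lemma homothetic_vertex_lattices:
  assumes A: "A \<in> vertex_lattices" and B: "scale a ` A \<in> vertex_lattices" and a: "a \<noteq> 0"
  shows "scale a ` A = A"
proof -
  have lat: "lattice A" "submod A" "dual 2 A \<subseteq> A" "A \<subseteq> dual 1 A"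
    using A by (auto simp: vertex_lattices_def lattice_submod)
  have no: "\<not> A \<subseteq> scale unif ` A" by (rule lattice_not_subset_unif[OF lat(1)])
  have shift: "scale a ` dual j A = dual (j + ord a) A" "dual j (scale a ` A) = dual (j - ord a) A"
    for j using scale_dual[OF a] dual_scale[OF a] by simp_all
  have 1: "dual (2 - ord a) A \<subseteq> scale a ` A" "scale a ` A \<subseteq> dual (1 - ord a) A"
    using B by (auto simp: vertex_lattices_def shift)
  have inv: "scale (inverse a) ` scale a ` X = X" for X
    using a by (simp add: scale_image_scale_image)
  have 2: "dual (2 - 2 * ord a) A \<subseteq> A"
    using image_mono[OF 1(1), of "scale (inverse a)"] scale_dual[of "inverse a" "2 - ord a" A] a
    by (simp add: inv ord_inverse)
  have 3: "A \<subseteq> dual (1 - 2 * ord a) A"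
    using image_mono[OF 1(2), of "scale (inverse a)"] scale_dual[of "inverse a" "1 - ord a" A] a
    by (simp add: inv ord_inverse)
  have "ord a = 0"
  proof (rule ccontr)
    assume "ord a \<noteq> 0"
    then consider "ord a \<le> - 1" | "ord a \<ge> 1" by linarith
    then show False
    proof cases
      case 1
      then have "A \<subseteq> dual 3 A" using 3 dual_level_mono[of 3 "1 - 2 * ord a" A] by auto
      also have "\<dots> = scale unif ` dual 2 A" using scale_unif_dual[of 2 A] by simp
      also have "\<dots> \<subseteq> scale unif ` A" using lat(3) by (rule image_mono)
      finally show False using no by blast
    next
      case 2
      then have "dual 0 A \<subseteq> A"
        using \<open>dual (2 - 2 * ord a) A \<subseteq> A\<close> dual_level_mono[of "2 - 2 * ord a" 0 A] by auto
      then have "scale unif ` dual 0 A \<subseteq> scale unif ` A" by (rule image_mono)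
      then show False using lat(4) scale_unif_dual[of 0 A] no by auto
    qed
  qed
  then show ?thesis using scale_image_unit[OF lat(2) a] by simp
qed

lemma homothety_class_self: "A \<in> homothety_class A"
  unfolding homothety_class_def by (force intro: exI[of _ 1])

lemma mem_homothety_class_unique:
  assumes "A \<in> vertex_lattices" "B \<in> vertex_lattices" "B \<in> homothety_class A"
  shows "B = A"
  using assms homothetic_vertex_lattices by (auto simp: homothety_class_def)

lemma inj_on_homothety_class: "inj_on homothety_class vertex_lattices"
  using mem_homothety_class_unique homothety_class_self by (metis inj_onI)

lemma incident_lattices_subset:
  assumes "A \<in> vertex_lattices" "B \<in> vertex_lattices" "A \<subseteq> B"
  obtains G where "primitive G" "scale unif ` G \<subseteq> A" "B \<subseteq> G"
proof -
  have AB: "A \<subseteq> dual 1 A" "B \<subseteq> dual 1 B" using assms by (auto simp: vertex_lattices_def)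
  obtain G where G: "lattice G" "dual 0 G = G" "dual 1 A \<subseteq> G" "scale unif ` G \<subseteq> A"
    by (rule exists_self_dual[OF assms(1)])
  moreover have "B \<subseteq> G" using AB G(3) dual_mono[OF assms(3), of 1] by blast
  ultimately show ?thesis using that by (simp add: primitive_iff_self_dual)
qed

text \<open>If \<open>A \<subseteq> B\<close>, a primitive lattice \<open>G\<close> from \<open>exists_self_dual\<close> for \<open>A\<close> also serves for \<open>B\<close>, since
\<open>B \<subseteq> dual 1 B \<subseteq> dual 1 A \<subseteq> G\<close>. In the other direction uniqueness of normalised representatives
identifies the lattices that witness incidence.\<close>

lemma incident_iff:
  assumes A: "A \<in> vertex_lattices" and B: "B \<in> vertex_lattices"
  shows "incident (homothety_class A) (homothety_class B) \<longleftrightarrow> comparable A B"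
proof
  assume "incident (homothety_class A) (homothety_class B)"
  then obtain L M G where LM: "L \<in> homothety_class A" "M \<in> homothety_class B"
    and G: "primitive G" "L \<subseteq> dual 1 L" "M \<subseteq> dual 1 M"
    and sub: "scale unif ` G \<subseteq> L \<and> L \<subseteq> M \<and> M \<subseteq> G \<or> scale unif ` G \<subseteq> M \<and> M \<subseteq> L \<and> L \<subseteq> G"
    by (auto simp: incident_def form_in_max_ideal_iff)
  have lat: "lattice L" "lattice M"
    using LM A B by (auto simp: homothety_class_def vertex_lattices_def lattice_scale_image)
  have "L \<in> vertex_lattices" "M \<in> vertex_lattices"
    using G sub lat by (auto simp: primitive_iff_self_dual intro!: mem_vertex_latticesI[of _ G])
  then have "L = A" "M = B" using LM A B mem_homothety_class_unique by blast+
  then show "comparable A B" using sub by (auto simp: comparable_def)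
next
  have dir: "A \<subseteq> dual 1 A" "B \<subseteq> dual 1 B" using A B by (auto simp: vertex_lattices_def)
  assume "comparable A B"
  then have "\<exists>G. primitive G \<and> (scale unif ` G \<subseteq> A \<and> A \<subseteq> B \<and> B \<subseteq> G \<or>
      scale unif ` G \<subseteq> B \<and> B \<subseteq> A \<and> A \<subseteq> G)"
    using incident_lattices_subset[OF A B] incident_lattices_subset[OF B A]
    unfolding comparable_def by metis
  then show "incident (homothety_class A) (homothety_class B)"
    unfolding incident_def form_in_max_ideal_iff vertices_eq
    using A B dir homothety_class_self by blast
qed

end

lemma card_fibres:
  assumes "finite X" "\<And>x. x \<in> X \<Longrightarrow> card {y \<in> X. f y = f x} = k"
  shows "card X = k * card (f ` X)"
proof -
  have "card X = (\<Sum>y\<in>f ` X. card {x \<in> X. f x = y})"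
    using sum.image_gen[OF assms(1), of "\<lambda>_. 1::nat" f] by simp
  also have "\<dots> = (\<Sum>y\<in>f ` X. k)"
    by (intro sum.cong refl) (auto simp: assms(2))
  finally show ?thesis by simp
qed

context nontrivial_symplectic_space
begin

section \<open>Neighbours of a minimal vertex lattice\<close>

lemma self_dual_submod: "dual j A = A \<Longrightarrow> submod A"
  using submod_dual[of j A] by simp

lemma self_dual_subset: "dual 2 A = A \<Longrightarrow> A \<subseteq> dual 1 A"
  using dual_level_mono[of 1 2 A] by simp

lemma self_dual_form: "dual 2 A = A \<Longrightarrow> x \<in> A \<Longrightarrow> y \<in> A \<Longrightarrow> val_ge (form x y) 2"
  using dualD by blast

text \<open>Here \<open>dual 1 A / A\<close> is a vector space over the residue field, because \<open>\<pi> dual 1 A = dual 2 A = A\<close>.\<close>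

lemma scale_mem_iff:
  assumes "dual 2 A = A" "x \<in> dual 1 A" "x \<notin> A" "val_ge c 0"
  shows "scale c x \<in> A \<longleftrightarrow> val_ge c 1"
proof
  assume "scale c x \<in> A"
  then have "val_ge (inverse c) 0 \<Longrightarrow> scale (inverse c) (scale c x) \<in> A"
    using self_dual_submod[OF assms(1)] submod_scale by blast
  then show "val_ge c 1"
    using assms(3,4) val_ge_inverse_unit[of c] by (cases "c = 0") auto
next
  assume c: "val_ge c 1"
  have "scale c x \<in> dual 2 A"
    using val_ge_mult[OF c dualD[OF assms(2)]] by (auto intro!: dualI simp: form_scale_left)
  then show "scale c x \<in> A" using assms(1) by simp
qed

lemma adjoin_eqI:
  assumes "submod A" "x \<in> adjoin A y" "y \<in> adjoin A x"
  shows "adjoin A x = adjoin A y"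
  using assms by (intro subset_antisym adjoin_subset submod_adjoin subset_adjoin)

lemma mem_adjoin_unit:
  assumes A: "dual 2 A = A" and x: "x \<in> dual 1 A" and z: "z \<in> adjoin A x" "z \<notin> A"
  obtains a c where "a \<in> A" "val_ge c 0" "\<not> val_ge c 1" "c \<noteq> 0" "z = a + scale c x"
proof -
  obtain a c where ac: "a \<in> A" "val_ge c 0" "z = a + scale c x"
    using z(1) by (auto simp: adjoin_def)
  have "x \<notin> A"
    using z(2) ac self_dual_submod[OF A] submod_add submod_scale by metis
  moreover have "scale c x \<notin> A"
    using z(2) ac self_dual_submod[OF A] submod_add by metis
  ultimately have "\<not> val_ge c 1" using scale_mem_iff[OF A x _ ac(2)] by blast
  then show ?thesis using that[of a c] ac by force
qed

text \<open>The quotient of \<open>A + Ox\<close> by \<open>A\<close> is a line over the residue field, so nothing lies properly between.\<close>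

lemma adjoin_covers:
  assumes A: "dual 2 A = A" and x: "x \<in> dual 1 A"
    and B: "submod B" "A \<subseteq> B" "B \<subseteq> adjoin A x"
  shows "B = A \<or> B = adjoin A x"
proof (rule disjCI)
  assume ne: "B \<noteq> adjoin A x"
  have "z \<in> A" if z: "z \<in> B" for z
  proof (rule ccontr)
    assume "z \<notin> A"
    then obtain a c where ac: "a \<in> A" "val_ge c 0" "\<not> val_ge c 1" "c \<noteq> 0" "z = a + scale c x"
      using mem_adjoin_unit[OF A x] z B(3) by (metis subsetD)
    then have "x = scale (inverse c) (z - a)" by simp
    moreover have "z - a \<in> B" using submod_diff[OF B(1)] z ac B(2) by blast
    ultimately have "x \<in> B" using submod_scale[OF B(1)] val_ge_inverse_unit[OF ac(2,3)] by metis
    then have "adjoin A x \<subseteq> B" by (intro adjoin_subset B(1,2))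
    with B(3) ne show False by blast
  qed
  with B(2) show "B = A" by blast
qed

text \<open>Since \<open>z\<close> lies in \<open>dual 1 A\<close> but not in \<open>dual 2 A = A\<close>, some pairing with \<open>A\<close> has valuation exactly 1.\<close>

lemma ex_partner:
  assumes "dual 2 A = A" "z \<in> dual 1 A" "z \<notin> A"
  obtains y where "y \<in> A" "form z y = unif"
proof -
  have "z \<notin> dual 2 A" using assms by simp
  then obtain y where y: "y \<in> A" "\<not> val_ge (form z y) 2" by (auto simp: dual_def)
  then have f: "val_ge (form z y) 1" using dualD[OF assms(2)] by blast
  then have ne: "form z y \<noteq> 0" "ord (form z y) = 1" using y(2) by (auto simp: val_ge_def)
  then have "val_ge (unif / form z y) 0"
    by (simp add: val_ge_def ord_divide ord_unif unif_nonzero)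
  then have "scale (unif / form z y) y \<in> A"
    using submod_scale[OF self_dual_submod[OF assms(1)]] y(1) by blast
  then show ?thesis using that ne by (simp add: form_scale_right)
qed

text \<open>The part of \<open>A\<close> orthogonal to \<open>z\<close> modulo \<open>\<pi>\<^sup>2\<close>, together with \<open>z\<close>. By \<open>eq_neighbour\<close> below this is the
only module \<open>M\<close> with \<open>dual 2 M = M\<close> and \<open>z \<in> M \<subseteq> A + Oz\<close>.\<close>

definition neighbour :: "'v set \<Rightarrow> 'v \<Rightarrow> 'v set" where
  "neighbour A z = adjoin (A \<inter> dual 2 {z}) z"

lemma mem_neighbour:
  "x \<in> neighbour A z \<longleftrightarrow> (\<exists>v c. x = v + scale c z \<and> v \<in> A \<and> val_ge (form v z) 2 \<and> val_ge c 0)"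
  by (auto simp: neighbour_def adjoin_def dual_def)

lemma neighbour_subset: "neighbour A z \<subseteq> adjoin A z"
  by (auto simp: mem_neighbour intro: adjoinI)

lemma self_mem_neighbour: "dual 2 A = A \<Longrightarrow> z \<in> neighbour A z"
  unfolding neighbour_def
  by (intro mem_adjoin) (use self_dual_submod[of 2 A] submod_dual[of 2 "{z}"] in \<open>auto simp: submod_def\<close>)

text \<open>The module \<open>neighbour A z\<close> is \<open>A\<close> with a partner \<open>y\<close> of \<open>z\<close> replaced by \<open>\<pi>y\<close> and with \<open>z\<close> in place of
\<open>\<pi>z\<close>. For a vector \<open>w\<close> in the dual, subtracting the multiple of \<open>z\<close> that makes it orthogonal to \<open>y\<close>
leaves a vector of \<open>dual 2 A = A\<close>.\<close>

lemma neighbour_self_dual: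
  assumes A: "dual 2 A = A" and z: "z \<in> dual 1 A" "z \<notin> A"
  shows "dual 2 (neighbour A z) = neighbour A z"
proof
  have isotropic: "A \<inter> dual 2 {z} \<subseteq> dual 2 (A \<inter> dual 2 {z})" "z \<in> dual 2 (A \<inter> dual 2 {z})"
    using self_dual_form[OF A] val_ge_form_commute by (auto simp: dual_def)
  then show "neighbour A z \<subseteq> dual 2 (neighbour A z)"
    unfolding neighbour_def by (rule adjoin_isotropic)
  note sub = self_dual_submod[OF A]
  obtain y where y: "y \<in> A" "form z y = unif" by (rule ex_partner[OF A z])
  show "dual 2 (neighbour A z) \<subseteq> neighbour A z"
  proof
    fix w assume w: "w \<in> dual 2 (neighbour A z)"
    have in_nb: "v \<in> neighbour A z" if "v \<in> A" "val_ge (form v z) 2" for v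
      using that unfolding mem_neighbour by (intro exI[of _ v] exI[of _ 0]) simp
    have "form y z = - unif" using y(2) form_commute[of y z] by simp
    then have "scale unif y \<in> neighbour A z"
      using val_ge_mult[of unif 1 unif 1] val_ge_mono[OF val_ge_unif, of 0]
      by (intro in_nb submod_scale[OF sub] y(1)) (simp_all add: form_scale_left)
    then have "val_ge (unif * form w y) 2"
      using dualD[OF w] form_scale_right by metis
    then have wy: "val_ge (form w y) 1" by (simp add: val_ge_cancel unif_nonzero ord_unif)
    define c where "c = form w y / unif"
    have c: "val_ge c 0" using val_ge_divide_unif[OF wy] by (simp add: c_def)
    \<comment> \<open>\<open>w'\<close> is orthogonal to \<open>y\<close>, and \<open>a - dy\<close> below is orthogonal to \<open>z\<close>\<close>
    define w' where "w' = w - scale c z"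
    have w'y: "form w' y = 0" using unif_nonzero by (simp add: w'_def form_simps c_def y(2))
    have "w' \<in> dual 2 A"
    proof (rule dualI)
      fix a assume a: "a \<in> A"
      define d where "d = form z a / unif"
      have d: "val_ge d 0" using val_ge_divide_unif[OF dualD[OF z(1) a]] by (simp add: d_def)
      have zero: "form z (a - scale d y) = 0"
        using unif_nonzero by (simp add: form_simps d_def y(2))
      have "a - scale d y \<in> neighbour A z"
        using zero val_ge_form_commute[of "a - scale d y" z 2] d a y(1)
        by (intro in_nb submod_diff[OF sub] submod_scale[OF sub]) simp_all
      then have "val_ge (form w (a - scale d y)) 2" by (rule dualD[OF w])
      also have "form w (a - scale d y) = form w' (a - scale d y)"
        using zero by (simp add: w'_def form_diff_left form_scale_left)
      also have "\<dots> = form w' a" using w'y by (simp add: form_diff_right form_scale_right)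
      finally show "val_ge (form w' a) 2" .
    qed
    then have "w' \<in> A" using A by simp
    moreover have "val_ge (form w' z) 2"
      using dualD[OF w self_mem_neighbour[OF A]] by (simp add: w'_def form_simps)
    moreover have "w = w' + scale c z" by (simp add: w'_def)
    ultimately show "w \<in> neighbour A z" unfolding mem_neighbour using c by blast
  qed
qed

text \<open>Isotropy of \<open>M\<close> gives \<open>M \<subseteq> neighbour A z\<close>; the reverse inclusion holds because the part of \<open>A\<close>
orthogonal to \<open>z\<close> modulo \<open>\<pi>\<^sup>2\<close> pairs with all of \<open>A + Oz \<supseteq> M\<close> into \<open>\<pi>\<^sup>2O\<close>, hence lies in \<open>dual 2 M = M\<close>.\<close>

lemma eq_neighbour:
  assumes A: "dual 2 A = A" and M: "dual 2 M = M" "M \<subseteq> adjoin A x" and x: "x \<in> dual 1 A"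
    and z: "z \<in> M" "z \<notin> A"
  shows "M = neighbour A z" "adjoin A z = adjoin A x" "z \<in> dual 1 A"
proof -
  note sub = self_dual_submod[OF A]
  have "z \<in> adjoin A x" using z M by blast
  then obtain a c where ac: "a \<in> A" "val_ge c 0" "\<not> val_ge c 1" "c \<noteq> 0" "z = a + scale c x"
    using mem_adjoin_unit[OF A x] z(2) by metis
  have x_eq: "x = scale (- inverse c) a + scale (inverse c) z"
    using ac by (simp add: scale_right_distrib)
  have ic: "val_ge (inverse c) 0" by (rule val_ge_inverse_unit[OF ac(2,3)])
  have "x \<in> adjoin A z"
    by (subst x_eq) (use ic submod_scale[OF sub _ ac(1)] in \<open>auto intro!: adjoinI simp del: scale_minus_left\<close>)
  then show adj: "adjoin A z = adjoin A x"
    using \<open>z \<in> adjoin A x\<close> by (intro adjoin_eqI[OF sub])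
  show zd: "z \<in> dual 1 A"
    using \<open>z \<in> adjoin A x\<close> adjoin_subset[OF submod_dual self_dual_subset[OF A] x] by blast
  show "M = neighbour A z"
  proof
    show "M \<subseteq> neighbour A z"
    proof
      fix w assume w: "w \<in> M"
      then have "w \<in> adjoin A z" using M(2) adj by blast
      then obtain v d where vd: "v \<in> A" "val_ge d 0" "w = v + scale d z" by (auto simp: adjoin_def)
      have "val_ge (form w z) 2" by (rule self_dual_form[OF M(1) w z(1)])
      then have "val_ge (form v z) 2" using vd(3) by (simp add: form_simps)
      then show "w \<in> neighbour A z" unfolding mem_neighbour using vd by blast
    qed
    show "neighbour A z \<subseteq> M"
      unfolding neighbour_def
    proof (intro adjoin_subset z(1) self_dual_submod[OF M(1)] subsetI)
      fix v assume v: "v \<in> A \<inter> dual 2 {z}"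
      have "v \<in> dual 2 M"
      proof (rule dualI)
        fix w assume "w \<in> M"
        then have "w \<in> adjoin A z" using M(2) adj by blast
        then obtain b d where "b \<in> A" "val_ge d 0" "w = b + scale d z" by (auto simp: adjoin_def)
        then show "val_ge (form v w) 2"
          using v self_dual_form[OF A] dualD[of v 2 "{z}" z]
          by (auto simp: form_simps intro!: val_ge_add val_ge_mult_left)
      qed
      then show "v \<in> M" using M(1) by simp
    qed
  qed
qed

text \<open>The lattice \<open>A\<close> is in turn a neighbour of \<open>neighbour A z\<close>: the two have the same join \<open>A + Oz\<close>, so
  \<open>adjoin_covers\<close> applies to both.\<close>

lemma adjoin_neighbour:
  assumes A: "dual 2 A = A" and z: "z \<in> dual 1 A" and y: "y \<in> A" "form z y = unif"
  shows "adjoin (neighbour A z) y = adjoin A z" "y \<in> dual 1 (neighbour A z)"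
proof -
  note sub = self_dual_submod[OF A]
  have subN: "submod (neighbour A z)"
    unfolding neighbour_def
    by (intro submod_adjoin) (use sub submod_dual[of 2 "{z}"] in \<open>auto simp: submod_def\<close>)
  show "adjoin (neighbour A z) y = adjoin A z"
  proof
    show "adjoin (neighbour A z) y \<subseteq> adjoin A z"
      using y(1) subset_adjoin[of A z] by (intro adjoin_subset submod_adjoin sub neighbour_subset) auto
    show "adjoin A z \<subseteq> adjoin (neighbour A z) y"
    proof (intro adjoin_subset submod_adjoin subN subsetI)
      fix a assume a: "a \<in> A"
      define d where "d = form z a / unif"
      have d: "val_ge d 0" using val_ge_divide_unif[OF dualD[OF z a]] by (simp add: d_def)
      have zero: "form z (a - scale d y) = 0"
        using unif_nonzero by (simp add: form_simps d_def y(2))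
      have "a - scale d y \<in> neighbour A z"
        unfolding mem_neighbour
        using zero val_ge_form_commute[of "a - scale d y" z 2] a d y(1) sub
        by (intro exI[of _ "a - scale d y"] exI[of _ 0]) (simp add: submod_diff submod_scale)
      then have "(a - scale d y) + scale d y \<in> adjoin (neighbour A z) y" using d by (rule adjoinI)
      then show "a \<in> adjoin (neighbour A z) y" by simp
    next
      show "z \<in> adjoin (neighbour A z) y"
        using subset_adjoin self_mem_neighbour[OF A] by blast
    qed
  qed
  show "y \<in> dual 1 (neighbour A z)"
  proof (rule dualI)
    fix w assume "w \<in> neighbour A z"
    then obtain v c where "w = v + scale c z" "v \<in> A" "val_ge c 0" by (auto simp: mem_neighbour)
    moreover have "form y z = - unif" using y(2) form_commute[of y z] by simp
    ultimately show "val_ge (form y w) 1"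
      using val_ge_mono[OF self_dual_form[OF A y(1), of v], of 1]
      by (auto simp: form_simps intro!: val_ge_diff val_ge_mult_left)
  qed
qed

text \<open>These will turn out to be the lattices close to \<open>A\<close>.\<close>

definition neighbours :: "'v set \<Rightarrow> 'v set set" where
  "neighbours A = {M. dual 2 M = M \<and> M \<noteq> A \<and> (\<exists>x\<in>dual 1 A. M \<subseteq> adjoin A x)}"

lemma self_dual_antisym: "dual 2 A = A \<Longrightarrow> dual 2 M = M \<Longrightarrow> M \<subseteq> A \<Longrightarrow> M = A"
  using dual_mono[of M A 2] by auto

lemma neighboursE:
  assumes A: "dual 2 A = A" and "M \<in> neighbours A"
  obtains z where "z \<in> M" "z \<notin> A" "z \<in> dual 1 A" "M = neighbour A z"
proof -
  obtain x where x: "x \<in> dual 1 A" "M \<subseteq> adjoin A x" and M: "dual 2 M = M" "M \<noteq> A"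
    using assms(2) by (auto simp: neighbours_def)
  then obtain z where z: "z \<in> M" "z \<notin> A" using self_dual_antisym[OF A M(1)] by blast
  then show ?thesis using that eq_neighbour[OF A M(1) x(2,1) z] by blast
qed

lemma neighbour_mem_neighbours:
  assumes A: "dual 2 A = A" and z: "z \<in> dual 1 A" "z \<notin> A"
  shows "neighbour A z \<in> neighbours A"
  using neighbour_self_dual[OF A z] self_mem_neighbour[OF A, of z] neighbour_subset[of A z] z
  unfolding neighbours_def by blast

lemma lattice_dual_one:
  assumes "lattice A" "dual 2 A = A"
  shows "lattice (dual 1 A)" "scale unif ` dual 1 A = A"
proof -
  show eq: "scale unif ` dual 1 A = A" using scale_unif_dual[of 1 A] assms(2) by simp
  have "scale (inverse unif) ` scale unif ` dual 1 A = dual 1 A"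
    using unif_nonzero by (simp add: scale_image_scale_image)
  then have "dual 1 A = scale (inverse unif) ` A" unfolding eq by (rule sym)
  also have "lattice \<dots>" using assms(1) unif_nonzero by (intro lattice_scale_image) simp_all
  finally show "lattice (dual 1 A)" .
qed

lemma lattice_adjoin:
  assumes "lattice A" "dual 2 A = A" "x \<in> dual 1 A"
  shows "lattice (adjoin A x)"
proof (rule lattice_sandwich[OF lattice_dual_one(1)[OF assms(1,2)]])
  show "submod (adjoin A x)" by (intro submod_adjoin self_dual_submod[OF assms(2)])
  show "scale unif ` dual 1 A \<subseteq> adjoin A x"
    unfolding lattice_dual_one(2)[OF assms(1,2)] by (rule subset_adjoin)
  show "adjoin A x \<subseteq> dual 1 A"
    by (intro adjoin_subset submod_dual self_dual_subset assms(2,3))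
qed

lemma lattice_neighbour:
  assumes A: "lattice A" "dual 2 A = A" and z: "z \<in> dual 1 A" "z \<notin> A"
  shows "lattice (neighbour A z)"
proof (rule lattice_sandwich[OF lattice_adjoin[OF A z(1)]])
  let ?N = "neighbour A z"
  note sub = self_dual_submod[OF A(2)] and subN = self_dual_submod[OF neighbour_self_dual[OF A(2) z]]
  show "submod ?N" by (rule subN)
  show "?N \<subseteq> adjoin A z" by (rule neighbour_subset)
  have "adjoin A z \<subseteq> scale (inverse unif) ` ?N"
  proof (intro adjoin_subset submod_scale_image[OF subN] subsetI)
    have unif: "val_ge unif 0" by (rule val_ge_mono[OF val_ge_unif]) simp
    fix a assume a: "a \<in> A"
    have "val_ge (form a z) 1"
      using dualD[OF z(1) a] val_ge_form_commute by blast
    then have "scale unif a \<in> ?N"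
      unfolding mem_neighbour using submod_scale[OF sub unif a] val_ge_mult[of unif 1 _ 1]
      by (intro exI[of _ "scale unif a"] exI[of _ 0]) (simp add: form_scale_left)
    then show "a \<in> scale (inverse unif) ` ?N" using unif_nonzero by (simp add: mem_scale_image)
  next
    have "scale unif z \<in> ?N"
      by (rule submod_scale[OF subN _ self_mem_neighbour[OF A(2)]]) (rule val_ge_mono[OF val_ge_unif], simp)
    then show "z \<in> scale (inverse unif) ` ?N" using unif_nonzero by (simp add: mem_scale_image)
  qed
  then show "scale unif ` adjoin A z \<subseteq> ?N" by (simp add: scale_unif_subset)
qed

definition lines :: "'v set \<Rightarrow> 'v set set" where
  "lines A = adjoin A ` (dual 1 A - A)"

text \<open>The \<open>q\<^sup>2\<^sup>n - 1\<close> nonzero classes of \<open>dual 1 A / A\<close> are distributed among the lines, and two classes give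
the same line iff they differ by one of the \<open>q - 1\<close> nonzero elements of the residue field.\<close>

lemma card_lines:
  assumes A: "lattice A" "dual 2 A = A"
  shows "finite (lines A)"
    and "(card residue_field - 1) * card (lines A) = card residue_field ^ (2 * n) - 1"
proof -
  let ?q = "card residue_field"
  note sub = self_dual_submod[OF A(2)]
  obtain R where R: "R \<subseteq> val_ring" "card R = ?q"
    "\<And>x. val_ge x 0 \<Longrightarrow> \<exists>r\<in>R. val_ge (x - r) 1"
    "\<And>r s. r \<in> R \<Longrightarrow> s \<in> R \<Longrightarrow> val_ge (r - s) 1 \<Longrightarrow> r = s" "finite R"
    using residue_representatives finite_residue_field by metis
  obtain T where T: "finite T" "card T = ?q ^ (2 * n)" "T \<subseteq> dual 1 A"
    "\<And>x. x \<in> dual 1 A \<Longrightarrow> \<exists>t\<in>T. x - t \<in> A"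
    "\<And>s t. s \<in> T \<Longrightarrow> t \<in> T \<Longrightarrow> s - t \<in> A \<Longrightarrow> s = t"
    using lattice_coset_representatives[OF lattice_dual_one(1)[OF A]] lattice_dual_one(2)[OF A]
    by metis
  have adj: "adjoin A x = adjoin A y" if xy: "x - y \<in> A" for x y
  proof (rule adjoin_eqI[OF sub])
    show "x \<in> adjoin A y" using adjoinI[OF xy val_ge_one, of y] by simp
    have "y - x \<in> A" using submod_minus[OF sub xy] by simp
    then show "y \<in> adjoin A x" using adjoinI[OF _ val_ge_one, of "y - x" A x] by simp
  qed
  \<comment> \<open>\<open>t0\<close> and \<open>r0\<close> represent the zero classes\<close>
  obtain t0 where "t0 \<in> T" "0 - t0 \<in> A" using T(4) submod_zero[OF submod_dual] by blast
  then have t0: "t0 \<in> T" "t0 \<in> A" using submod_minus[OF sub, of "- t0"] by simp_all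
  have "T - A = T - {t0}" using t0 T(5) submod_diff[OF sub] by blast
  then have cardTA: "card (T - A) = ?q ^ (2 * n) - 1" using t0 T(1,2) by simp
  obtain r0 where r0: "r0 \<in> R" "val_ge r0 1" using R(3)[of 0] by auto
  define R' where "R' = {r \<in> R. \<not> val_ge r 1}"
  have "R' = R - {r0}" using r0 R(4) val_ge_diff by (auto simp: R'_def)
  then have cardR': "card R' = ?q - 1" using r0 R(2,5) by simp
  have lines: "lines A = adjoin A ` (T - A)"
  proof
    show "adjoin A ` (T - A) \<subseteq> lines A" using T(3) by (auto simp: lines_def)
    show "lines A \<subseteq> adjoin A ` (T - A)"
    proof
      fix l assume "l \<in> lines A"
      then obtain z where z: "z \<in> dual 1 A" "z \<notin> A" "l = adjoin A z" by (auto simp: lines_def)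
      obtain t where t: "t \<in> T" "z - t \<in> A" using T(4) z by blast
      moreover have "t \<notin> A" using submod_add[OF sub t(2), of t] z(2) by auto
      ultimately show "l \<in> adjoin A ` (T - A)" using adj z(3) by blast
    qed
  qed
  have "card {t \<in> T - A. adjoin A t = adjoin A s} = ?q - 1" if s: "s \<in> T - A" for s
  proof -
    have sd: "s \<in> dual 1 A" "s \<notin> A" using s T(3) by auto
    \<comment> \<open>the representative of the class of \<open>rs\<close>\<close>
    define h where "h r = (SOME t. t \<in> T \<and> scale r s - t \<in> A)" for r
    have h: "h r \<in> T" "scale r s - h r \<in> A" if "r \<in> R" for r
    proof -
      have "scale r s \<in> dual 1 A" using that R(1) sd by (intro submod_scale[OF submod_dual]) auto
      then have "\<exists>t. t \<in> T \<and> scale r s - t \<in> A" using T(4) by blast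
      then have "h r \<in> T \<and> scale r s - h r \<in> A" unfolding h_def by (rule someI_ex)
      then show "h r \<in> T" "scale r s - h r \<in> A" by blast+
    qed
    have "inj_on h R'"
    proof (rule inj_onI)
      fix r r' assume r: "r \<in> R'" "r' \<in> R'" "h r = h r'"
      then have rR: "r \<in> R" "r' \<in> R" by (auto simp: R'_def)
      have "scale (r - r') s = (scale r s - h r) - (scale r' s - h r')"
        using r(3) by (simp add: scale_left_diff_distrib)
      then have "scale (r - r') s \<in> A" using submod_diff[OF sub h(2) h(2)] rR by metis
      moreover have "val_ge (r - r') 0" using rR R(1) by (intro val_ge_diff) auto
      ultimately show "r = r'" using scale_mem_iff[OF A(2) sd] R(4) rR by blast
    qed
    moreover have "h ` R' = {t \<in> T - A. adjoin A t = adjoin A s}"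
    proof (intro subset_antisym subsetI)
      fix t assume "t \<in> h ` R'"
      then obtain r where r: "r \<in> R" "\<not> val_ge r 1" "t = h r" by (auto simp: R'_def)
      have r0: "val_ge r 0" using r R(1) by auto
      have t: "t \<in> T" "scale r s - t \<in> A" using h r by auto
      have "scale r s \<notin> A" using scale_mem_iff[OF A(2) sd r0] r(2) by blast
      then have "t \<notin> A" using submod_add[OF sub t(2), of t] by auto
      moreover have "adjoin A t = adjoin A (scale r s)" using adj[OF t(2)] by simp
      moreover have "adjoin A (scale r s) = adjoin A s"
      proof (rule adjoin_eqI[OF sub])
        show "scale r s \<in> adjoin A s" using adjoinI[OF submod_zero[OF sub] r0, of s] by simp
        have "r \<noteq> 0" using r(2) by auto
        then show "s \<in> adjoin A (scale r s)"
          using adjoinI[OF submod_zero[OF sub] val_ge_inverse_unit[OF r0 r(2)], of "scale r s"] by simp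
      qed
      ultimately show "t \<in> {t \<in> T - A. adjoin A t = adjoin A s}" using t by simp
    next
      fix t assume "t \<in> {t \<in> T - A. adjoin A t = adjoin A s}"
      then have t: "t \<in> T" "t \<notin> A" "t \<in> adjoin A s" using mem_adjoin[OF sub, of t] by auto
      obtain a c where ac: "a \<in> A" "val_ge c 0" "\<not> val_ge c 1" "t = a + scale c s"
        using mem_adjoin_unit[OF A(2) sd(1) t(3,2)] by metis
      obtain r where r: "r \<in> R" "val_ge (c - r) 1" using R(3)[OF ac(2)] by blast
      then have rR': "r \<in> R'" using ac(3) val_ge_add[of "c - r" 1 r] by (auto simp: R'_def)
      have "scale (c - r) s \<in> A"
        using scale_mem_iff[OF A(2) sd, of "c - r"] r(2) val_ge_mono[OF r(2), of 0] by simp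
      then have "(a + scale (c - r) s) + (scale r s - h r) \<in> A"
        using h(2)[OF r(1)] ac(1) by (intro submod_add[OF sub])
      then have "t - h r \<in> A" using ac(4) by (simp add: scale_left_diff_distrib algebra_simps)
      then have "t = h r" using T(5) t(1) h(1)[OF r(1)] by blast
      then show "t \<in> h ` R'" using rR' by blast
    qed
    ultimately show ?thesis using card_image cardR' by metis
  qed
  then have "card (T - A) = (?q - 1) * card (adjoin A ` (T - A))"
    using T(1) by (intro card_fibres) auto
  then show "(?q - 1) * card (lines A) = ?q ^ (2 * n) - 1" using cardTA lines by simp
  show "finite (lines A)" using lines T(1) by simp
qed

text \<open>A neighbour on the line of \<open>x\<close> contains a vector \<open>x + b\<close> with \<open>b \<in> A\<close>. Changing \<open>b\<close> by a vector
orthogonal to \<open>x\<close> modulo \<open>\<pi>\<^sup>2\<close> does not change the neighbour, so \<open>b\<close> can be taken to be \<open>ry\<close>, where \<open>y\<close>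
is a partner of \<open>x\<close> and \<open>r\<close> runs through representatives of the residue field. Distinct \<open>r\<close>, \<open>s\<close> give
distinct neighbours since \<open>x + ry\<close> and \<open>x + sy\<close> pair to \<open>\<pi>(s - r)\<close>.\<close>

lemma card_neighbours_on_line:
  assumes A: "dual 2 A = A" and x: "x \<in> dual 1 A" "x \<notin> A"
  shows "card {M \<in> neighbours A. M \<subseteq> adjoin A x} = card residue_field"
    and "finite {M \<in> neighbours A. M \<subseteq> adjoin A x}"
proof -
  note sub = self_dual_submod[OF A]
  obtain R where R: "R \<subseteq> val_ring" "card R = card residue_field"
    "\<And>x. val_ge x 0 \<Longrightarrow> \<exists>r\<in>R. val_ge (x - r) 1"
    "\<And>r s. r \<in> R \<Longrightarrow> s \<in> R \<Longrightarrow> val_ge (r - s) 1 \<Longrightarrow> r = s" "finite R"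
    using residue_representatives finite_residue_field by metis
  obtain y where y: "y \<in> A" "form x y = unif" by (rule ex_partner[OF A x])
  have yx: "form y x = - unif" using y(2) form_commute[of y x] by simp
  define z where "z r = x + scale r y" for r
  have zr: "z r \<in> dual 1 A" "z r \<notin> A" "adjoin A (z r) = adjoin A x" if "r \<in> R" for r
  proof -
    have ry: "scale r y \<in> A" using that R(1) y(1) submod_scale[OF sub] by auto
    then show "z r \<in> dual 1 A"
      using x(1) self_dual_subset[OF A] submod_add[OF submod_dual] unfolding z_def by blast
    have "x = z r - scale r y" by (simp add: z_def)
    then show "z r \<notin> A" using ry x(2) submod_diff[OF sub] by metis
    show "adjoin A (z r) = adjoin A x"
    proof (rule adjoin_eqI[OF sub])
      show "z r \<in> adjoin A x" using adjoinI[OF ry val_ge_one, of x] by (simp add: z_def add.commute)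
      show "x \<in> adjoin A (z r)"
        using adjoinI[OF submod_minus[OF sub ry] val_ge_one, of "z r"] by (simp add: z_def)
    qed
  qed
  have eq: "{M \<in> neighbours A. M \<subseteq> adjoin A x} = (\<lambda>r. neighbour A (z r)) ` R"
  proof (intro subset_antisym subsetI)
    fix M assume "M \<in> (\<lambda>r. neighbour A (z r)) ` R"
    then show "M \<in> {M \<in> neighbours A. M \<subseteq> adjoin A x}"
      using zr neighbour_mem_neighbours[OF A] neighbour_subset by blast
  next
    fix M assume M: "M \<in> {M \<in> neighbours A. M \<subseteq> adjoin A x}"
    then have Md: "dual 2 M = M" "M \<subseteq> adjoin A x" by (auto simp: neighbours_def)
    note subM = self_dual_submod[OF Md(1)]
    obtain w where w: "w \<in> M" "w \<notin> A" using neighboursE[OF A] M by blast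
    then obtain a c where ac: "a \<in> A" "val_ge c 0" "\<not> val_ge c 1" "c \<noteq> 0" "w = a + scale c x"
      using mem_adjoin_unit[OF A x(1)] Md(2) by (metis subsetD)
    have ic: "val_ge (inverse c) 0" by (rule val_ge_inverse_unit[OF ac(2,3)])
    \<comment> \<open>rescaling \<open>w\<close> makes its coefficient at \<open>x\<close> equal to 1\<close>
    define b where "b = scale (inverse c) a"
    have b: "b \<in> A" using submod_scale[OF sub ic ac(1)] by (simp add: b_def)
    have "scale (inverse c) w = x + b"
      using ac by (simp add: b_def scale_right_distrib add.commute)
    then have xb: "x + b \<in> M" using submod_scale[OF subM ic w(1)] by simp
    have xbA: "x + b \<notin> A"
      using submod_diff[OF sub _ b, of "x + b"] x(2) by auto
    have Mn: "M = neighbour A (x + b)" by (rule eq_neighbour(1)[OF A Md x(1) xb xbA])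
    have "val_ge (form x b / unif) 0" using val_ge_divide_unif[OF dualD[OF x(1) b]] by simp
    then obtain r where r: "r \<in> R" "val_ge (form x b / unif - r) 1" using R(3) by blast
    have ry: "scale r y \<in> A" using r R(1) y(1) submod_scale[OF sub] by auto
    have "form (scale r y - b) (x + b) = unif * (form x b / unif - r) + form (scale r y) b"
      using yx form_commute[of b x] unif_nonzero by (simp add: form_simps algebra_simps)
    moreover have "val_ge (unif * (form x b / unif - r)) 2"
      using val_ge_mult[OF val_ge_unif r(2)] by simp
    ultimately have "val_ge (form (scale r y - b) (x + b)) 2"
      using self_dual_form[OF A ry b] by (simp add: val_ge_add)
    then have "z r \<in> neighbour A (x + b)"
      unfolding mem_neighbour using submod_diff[OF sub ry b]
      by (intro exI[of _ "scale r y - b"] exI[of _ 1]) (simp add: z_def)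
    then have "M = neighbour A (z r)"
      using eq_neighbour(1)[OF A Md x(1), of "z r"] zr(2)[OF r(1)] Mn by blast
    then show "M \<in> (\<lambda>r. neighbour A (z r)) ` R" using r(1) by blast
  qed
  have "inj_on (\<lambda>r. neighbour A (z r)) R"
  proof (rule inj_onI)
    fix r s assume rs: "r \<in> R" "s \<in> R" "neighbour A (z r) = neighbour A (z s)"
    then have "z s \<in> neighbour A (z r)" "z r \<in> neighbour A (z r)"
      using self_mem_neighbour[OF A] by auto
    then have "val_ge (form (z s) (z r)) 2"
      using self_dual_form[OF neighbour_self_dual[OF A zr(1,2)[OF rs(1)]]] by blast
    moreover have "form (z s) (z r) = unif * (r - s)"
      using y(2) yx by (simp add: z_def form_simps algebra_simps)
    ultimately have "val_ge (r - s) 1" by (simp add: val_ge_cancel unif_nonzero ord_unif)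
    then show "r = s" using R(4) rs by blast
  qed
  then show "card {M \<in> neighbours A. M \<subseteq> adjoin A x} = card residue_field"
    using eq card_image R(2) by metis
  show "finite {M \<in> neighbours A. M \<subseteq> adjoin A x}" using eq R(5) by simp
qed

text \<open>Each neighbour lies on one line only: it contains some \<open>z\<close> outside \<open>A\<close>, and then the line is \<open>A + Oz\<close>.\<close>

lemma card_neighbours:
  assumes A: "lattice A" "dual 2 A = A"
  shows "finite (neighbours A)" "card (neighbours A) = card residue_field * card (lines A)"
proof -
  define on where "on l = {M \<in> neighbours A. M \<subseteq> l}" for l
  have on: "card (on l) = card residue_field" "finite (on l)" if l: "l \<in> lines A" for l
  proof -
    obtain x where "x \<in> dual 1 A" "x \<notin> A" "l = adjoin A x" using l by (auto simp: lines_def)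
    then show "card (on l) = card residue_field" "finite (on l)"
      using card_neighbours_on_line[OF A(2)] by (simp_all add: on_def)
  qed
  have "M \<in> (\<Union>l\<in>lines A. on l)" if M: "M \<in> neighbours A" for M
  proof -
    obtain z where "z \<in> M" "z \<notin> A" "z \<in> dual 1 A" "M = neighbour A z"
      by (rule neighboursE[OF A(2) M])
    then show ?thesis using M neighbour_subset[of A z] by (auto simp: on_def lines_def)
  qed
  then have un: "neighbours A = (\<Union>l\<in>lines A. on l)" by (auto simp: on_def)
  have "l = l'" if ll: "l \<in> lines A" "l' \<in> lines A" "M \<in> on l" "M \<in> on l'" for l l' M
  proof -
    have M: "dual 2 M = M" "M \<in> neighbours A" using ll by (auto simp: on_def neighbours_def)
    obtain z where z: "z \<in> M" "z \<notin> A" using neighboursE[OF A(2) M(2)] by metis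
    have "l = adjoin A z" if "l \<in> lines A" "M \<in> on l" for l
      using that eq_neighbour(2)[OF A(2) M(1) _ _ z] by (auto simp: lines_def on_def)
    then show ?thesis using ll by metis
  qed
  then have "\<forall>l\<in>lines A. \<forall>l'\<in>lines A. l \<noteq> l' \<longrightarrow> on l \<inter> on l' = {}" by blast
  then have "card (\<Union>l\<in>lines A. on l) = (\<Sum>l\<in>lines A. card (on l))"
    using card_lines(1)[OF A] on(2) by (intro card_UN_disjoint) auto
  then show "card (neighbours A) = card residue_field * card (lines A)"
    using on(1) by (simp add: un)
  show "finite (neighbours A)" using un on(2) card_lines(1)[OF A] by simp
qed

end

section \<open>Maximal cliques with a common facet\<close>

text \<open>Chambers are the maximal cliques of the incidence relation, and maximal chains of a poset are those
of comparability. A common definition lets closeness be carried along isomorphisms between these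
structures.\<close>

definition maximal_clique :: "('a \<Rightarrow> 'a \<Rightarrow> bool) \<Rightarrow> 'a set \<Rightarrow> 'a set \<Rightarrow> bool" where
  "maximal_clique R P C \<longleftrightarrow> finite C \<and> C \<subseteq> P \<and> pairwise R C \<and>
     (\<forall>X\<in>P. (\<forall>Y\<in>C. X \<noteq> Y \<longrightarrow> R X Y \<and> R Y X) \<longrightarrow> X \<in> C)"

text \<open>The members of \<open>F\<close> form the common facet of two adjacent chambers.\<close>

definition clique_close :: "('a \<Rightarrow> 'a \<Rightarrow> bool) \<Rightarrow> 'a set \<Rightarrow> 'a \<Rightarrow> 'a \<Rightarrow> bool" where
  "clique_close R P A B \<longleftrightarrow> A \<noteq> B \<and>
     (\<exists>F. A \<notin> F \<and> B \<notin> F \<and> maximal_clique R P (insert A F) \<and> maximal_clique R P (insert B F))"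

lemma clique_close_mem: "clique_close R P A B \<Longrightarrow> B \<in> P"
  by (auto simp: clique_close_def maximal_clique_def)

lemma maximal_clique_image:
  assumes f: "bij_betw f P Q" and R: "\<And>X Y. X \<in> P \<Longrightarrow> Y \<in> P \<Longrightarrow> R X Y \<longleftrightarrow> S (f X) (f Y)"
    and C: "maximal_clique R P C"
  shows "maximal_clique S Q (f ` C)"
  unfolding maximal_clique_def
proof (intro conjI ballI impI)
  have C': "finite C" "C \<subseteq> P" "pairwise R C"
    and max: "\<And>X. X \<in> P \<Longrightarrow> (\<And>Y. Y \<in> C \<Longrightarrow> X \<noteq> Y \<Longrightarrow> R X Y \<and> R Y X) \<Longrightarrow> X \<in> C"
    using C by (auto simp: maximal_clique_def)
  show "finite (f ` C)" "f ` C \<subseteq> Q" using C' f by (auto simp: bij_betw_def)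
  show "pairwise S (f ` C)" using C' R by (auto simp: pairwise_def subset_iff)
  fix X' assume "X' \<in> Q" and X': "\<forall>Y\<in>f ` C. X' \<noteq> Y \<longrightarrow> S X' Y \<and> S Y X'"
  then obtain X where X: "X \<in> P" "X' = f X" using f by (auto simp: bij_betw_def)
  have "X \<in> C"
  proof (rule max[OF X(1)])
    fix Y assume Y: "Y \<in> C" "X \<noteq> Y"
    then have "f X \<noteq> f Y" using f C' X by (auto simp: bij_betw_def inj_on_def)
    then have "S (f X) (f Y) \<and> S (f Y) (f X)" using X' X(2) Y(1) by blast
    then show "R X Y \<and> R Y X" using R X(1) Y(1) C'(2) by blast
  qed
  then show "X' \<in> f ` C" using X(2) by blast
qed

lemma clique_close_image:
  assumes f: "bij_betw f P Q" and R: "\<And>X Y. X \<in> P \<Longrightarrow> Y \<in> P \<Longrightarrow> R X Y \<longleftrightarrow> S (f X) (f Y)"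
    and AB: "clique_close R P A B"
  shows "clique_close S Q (f A) (f B)"
proof -
  obtain F where F: "A \<noteq> B" "A \<notin> F" "B \<notin> F"
    "maximal_clique R P (insert A F)" "maximal_clique R P (insert B F)"
    using AB by (auto simp: clique_close_def)
  have P: "insert A F \<subseteq> P" "insert B F \<subseteq> P" using F(4,5) unfolding maximal_clique_def by blast+
  have inj: "inj_on f P" using f by (simp add: bij_betw_def)
  have "f A \<noteq> f B" "f A \<notin> f ` F" "f B \<notin> f ` F"
    using F(1-3) P inj unfolding inj_on_def by blast+
  moreover have "maximal_clique S Q (insert (f A) (f ` F))" "maximal_clique S Q (insert (f B) (f ` F))"
    using maximal_clique_image[OF f R F(4)] maximal_clique_image[OF f R F(5)] by simp_all
  ultimately show ?thesis unfolding clique_close_def by blast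
qed

lemma clique_close_Collect_image:
  assumes f: "bij_betw f P Q" and R: "\<And>X Y. X \<in> P \<Longrightarrow> Y \<in> P \<Longrightarrow> R X Y \<longleftrightarrow> S (f X) (f Y)"
    and A: "A \<in> P"
  shows "{b. clique_close S Q (f A) b} = f ` {B. clique_close R P A B}"
proof (intro subset_antisym subsetI)
  fix b assume "b \<in> f ` {B. clique_close R P A B}"
  then show "b \<in> {b. clique_close S Q (f A) b}" using clique_close_image[where R = R and S = S, OF f R] by auto
next
  fix b assume "b \<in> {b. clique_close S Q (f A) b}"
  then have b: "clique_close S Q (f A) b" by simp
  define g where "g = inv_into P f"
  have g: "bij_betw g Q P" unfolding g_def by (rule bij_betw_inv_into[OF f])
  have fg: "f (g y) = y" "g y \<in> P" if "y \<in> Q" for y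
    using that f g by (auto simp: g_def bij_betw_def f_inv_into_f)
  have "clique_close R P (g (f A)) (g b)"
    by (rule clique_close_image[where R = S and S = R, OF g _ b]) (use R fg in simp)
  moreover have "g (f A) = A" using f A by (simp add: g_def bij_betw_def)
  moreover have "f (g b) = b" using fg clique_close_mem[OF b] by blast
  ultimately show "b \<in> f ` {B. clique_close R P A B}" by (metis imageI mem_Collect_eq)
qed

text \<open>Every clique containing \<open>A\<close> consists of elements related to \<open>A\<close>, so finitely many of these suffice
for maximal cliques to exist.\<close>

lemma ex_maximal_clique:
  assumes A: "A \<in> C0" and C0: "C0 \<subseteq> P" "pairwise R C0"
    and fin: "finite {X \<in> P. X \<noteq> A \<longrightarrow> R X A}"
  obtains C where "C0 \<subseteq> C" "maximal_clique R P C"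
proof -
  define Q where "Q = {X \<in> P. X \<noteq> A \<longrightarrow> R X A}"
  define K where "K = {C. C \<subseteq> Q \<and> C0 \<subseteq> C \<and> pairwise R C}"
  have finQ: "finite Q" using fin by (simp add: Q_def)
  then have "finite K" by (auto simp: K_def intro: finite_subset[of _ "Pow Q"])
  moreover have "C0 \<in> K" using A C0 by (auto simp: K_def Q_def pairwise_def)
  ultimately obtain C where C: "C \<in> K" "\<And>D. D \<in> K \<Longrightarrow> C \<subseteq> D \<Longrightarrow> C = D"
    using finite_has_maximal[of K] by (metis empty_iff)
  then have C': "C \<subseteq> Q" "C0 \<subseteq> C" "pairwise R C" by (auto simp: K_def)
  have "X \<in> C" if X: "X \<in> P" "\<forall>Y\<in>C. X \<noteq> Y \<longrightarrow> R X Y \<and> R Y X" for X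
  proof -
    have "X \<in> Q" using X A C'(2) by (auto simp: Q_def)
    moreover have "pairwise R (insert X C)" using C'(3) X(2) by (auto simp: pairwise_insert)
    ultimately have "insert X C \<in> K" using C' by (auto simp: K_def)
    then show "X \<in> C" using C(2)[of "insert X C"] by blast
  qed
  then have "maximal_clique R P C"
    using C' finQ unfolding maximal_clique_def by (auto simp: Q_def intro: finite_subset)
  with C'(2) that show ?thesis by blast
qed

lemma maximal_chain_mem:
  assumes "maximal_clique comparable P C" "X \<in> P" "\<And>Y. Y \<in> C \<Longrightarrow> comparable X Y"
  shows "X \<in> C"
  using assms unfolding maximal_clique_def comparable_def by metis

lemma comparable_chain_min:
  assumes "finite F" "F \<noteq> {}" "pairwise comparable F"
  obtains m where "m \<in> F" "\<And>X. X \<in> F \<Longrightarrow> m \<subseteq> X"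
proof -
  obtain m where m: "m \<in> F" "\<And>X. X \<in> F \<Longrightarrow> X \<subseteq> m \<Longrightarrow> m = X"
    using finite_has_minimal[OF assms(1,2)] by metis
  have "m \<subseteq> X" if "X \<in> F" for X
    using m that assms(3) by (cases "X = m") (auto simp: pairwise_def comparable_def)
  with m(1) that show ?thesis by blast
qed

context symplectic_space
begin

lemma chamber_iff_maximal_clique: "chamber C \<longleftrightarrow> maximal_clique incident vertices C"
proof
  assume C: "chamber C"
  then have s: "simplex C" and max: "\<And>S. simplex S \<Longrightarrow> C \<subseteq> S \<Longrightarrow> S = C"
    by (auto simp: chamber_def)
  show "maximal_clique incident vertices C"
    unfolding maximal_clique_def
  proof (intro conjI ballI impI)
    show "finite C" "C \<subseteq> vertices" "pairwise incident C" using s by (simp_all add: simplex_def)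
    fix X assume "X \<in> vertices" "\<forall>Y\<in>C. X \<noteq> Y \<longrightarrow> incident X Y \<and> incident Y X"
    then have "simplex (insert X C)" using s by (auto simp: simplex_def pairwise_insert)
    then show "X \<in> C" using max[of "insert X C"] by blast
  qed
next
  assume C: "maximal_clique incident vertices C"
  show "chamber C"
    unfolding chamber_def
  proof (intro conjI allI impI)
    show "simplex C" using C by (simp add: simplex_def maximal_clique_def)
    fix S assume S: "simplex S" "C \<subseteq> S"
    have "X \<in> C" if X: "X \<in> S" for X
    proof -
      have "X \<in> vertices" using S X by (auto simp: simplex_def)
      moreover have "incident X Y \<and> incident Y X" if "Y \<in> C" "X \<noteq> Y" for Y
        using S X that pairwiseD[of incident S] unfolding simplex_def by (metis subsetD)
      ultimately show ?thesis using C by (simp add: maximal_clique_def)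
    qed
    then show "S = C" using S(2) by blast
  qed
qed

text \<open>As \<open>t\<close> and \<open>t'\<close> avoid the common facet, each is the one vertex that its chamber has beyond the facet.\<close>

lemma close_iff_clique_close: "close t t' \<longleftrightarrow> clique_close incident vertices t t'"
proof
  assume "close t t'"
  then obtain C C' F where C: "chamber C" "chamber C'"
    and F: "F \<subseteq> C" "card C = Suc (card F)" "F \<subseteq> C'" "card C' = Suc (card F)"
    and t: "t \<in> C" "t' \<in> C'" "t \<notin> C \<inter> C'" "t' \<notin> C \<inter> C'"
    by (auto simp: close_def adjacent_def codim_one_face_def)
  have fin: "finite C" "finite C'" using C by (auto simp: chamber_def simplex_def)
  have tF: "t \<notin> F" "t' \<notin> F" using t F by auto
  have "insert t F = C"
    using fin(1) F t tF card_subset_eq[of C "insert t F"] finite_subset[OF F(1) fin(1)] by simp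
  moreover have "insert t' F = C'"
    using fin(2) F t tF card_subset_eq[of C' "insert t' F"] finite_subset[OF F(3) fin(2)] by simp
  moreover have "t \<noteq> t'" using t by auto
  ultimately show "clique_close incident vertices t t'"
    using C tF unfolding clique_close_def chamber_iff_maximal_clique by blast
next
  assume "clique_close incident vertices t t'"
  then obtain F where F: "t \<noteq> t'" "t \<notin> F" "t' \<notin> F" "chamber (insert t F)" "chamber (insert t' F)"
    by (auto simp: clique_close_def chamber_iff_maximal_clique)
  then have v: "finite F" "t \<in> vertices" "t' \<in> vertices" by (auto simp: chamber_def simplex_def)
  then have "adjacent (insert t F) (insert t' F)"
    unfolding adjacent_def codim_one_face_def using F by (intro conjI exI[of _ F]) auto
  then show "close t t'"
    unfolding close_def
    by (intro conjI v exI[of _ "insert t F"] exI[of _ "insert t' F"]) (use F in auto)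
qed

end

section \<open>Vertices close to a minimal vertex lattice\<close>

context nontrivial_symplectic_space
begin

lemma self_dual_vertex: "lattice A \<Longrightarrow> dual 2 A = A \<Longrightarrow> A \<in> vertex_lattices"
  using self_dual_subset by (simp add: vertex_lattices_def)

lemma self_dual_minimal:
  assumes "dual 2 A = A" "B \<in> vertex_lattices" "B \<subseteq> A"
  shows "B = A"
  using dual_mono[OF assms(3), of 2] assms by (auto simp: vertex_lattices_def)

text \<open>Below \<open>M\<close> lies \<open>\<pi>G\<close> for a primitive lattice \<open>G\<close>, and \<open>\<pi>G\<close> is itself a vertex lattice.\<close>

lemma minimal_self_dual:
  assumes M: "M \<in> vertex_lattices" "\<And>N. N \<in> vertex_lattices \<Longrightarrow> N \<subseteq> M \<Longrightarrow> N = M"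
  shows "dual 2 M = M"
proof -
  obtain G where G: "lattice G" "dual 0 G = G" "dual 1 M \<subseteq> G" "scale unif ` G \<subseteq> M"
    by (rule exists_self_dual[OF M(1)])
  have sd: "dual 2 (scale unif ` G) = scale unif ` G"
    using scale_unif_dual[of 0 G] dual_scale_unif[of 2 G] G(2) by simp
  have "scale unif ` G \<in> vertex_lattices"
    using G(1) unif_nonzero by (intro self_dual_vertex sd lattice_scale_image)
  then show ?thesis using M(2)[OF _ G(4)] sd by simp
qed

lemma adjoin_vertex:
  assumes "lattice A" "dual 2 A = A" "x \<in> dual 1 A"
  shows "adjoin A x \<in> vertex_lattices"
proof -
  have "dual 2 (adjoin A x) \<subseteq> A" using dual_mono[OF subset_adjoin[of A x], of 2] assms(2) by simp
  then have "dual 2 (adjoin A x) \<subseteq> adjoin A x" using subset_adjoin by blast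
  moreover have "adjoin A x \<subseteq> dual 1 (adjoin A x)"
    by (rule adjoin_isotropic[OF self_dual_subset[OF assms(2)] assms(3)])
  ultimately show ?thesis using lattice_adjoin[OF assms] by (simp add: vertex_lattices_def)
qed

lemma finite_comparable:
  assumes "lattice A" "dual 2 A = A"
  shows "finite {X \<in> vertex_lattices. X \<noteq> A \<longrightarrow> comparable X A}"
proof (rule finite_subset[OF _ finite_submods_between[OF lattice_dual_one(1)[OF assms]]])
  have "submod X \<and> A \<subseteq> X \<and> X \<subseteq> dual 1 A"
    if X: "X \<in> vertex_lattices" "X \<noteq> A \<longrightarrow> comparable X A" for X
  proof -
    have AX: "A \<subseteq> X" using X self_dual_minimal[OF assms(2) X(1)] by (auto simp: comparable_def)
    have "X \<subseteq> dual 1 X" using X by (simp add: vertex_lattices_def)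
    also have "\<dots> \<subseteq> dual 1 A" by (rule dual_mono[OF AX])
    finally show ?thesis using AX vertex_lattice_submod[OF X(1)] by blast
  qed
  then show "{X \<in> vertex_lattices. X \<noteq> A \<longrightarrow> comparable X A}
      \<subseteq> {N. submod N \<and> scale unif ` dual 1 A \<subseteq> N \<and> N \<subseteq> dual 1 A}"
    unfolding lattice_dual_one(2)[OF assms] by blast
qed

lemma ex_not_mem_dual_one:
  assumes "lattice A" "dual 2 A = A"
  obtains x where "x \<in> dual 1 A" "x \<notin> A"
proof -
  have "\<not> dual 1 A \<subseteq> A"
    using lattice_not_subset_unif[OF lattice_dual_one(1)[OF assms]] lattice_dual_one(2)[OF assms] by simp
  with that show ?thesis by blast
qed

text \<open>Let \<open>m\<close> be the least element of the common facet \<open>F\<close>. Maximality of the chain \<open>F \<union> {A}\<close> forces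
\<open>m = A + Ox\<close> and keeps \<open>M\<close> from containing \<open>m\<close>, since otherwise \<open>M\<close> could be added to it. So \<open>M \<subseteq> m\<close>, and
maximality of \<open>F \<union> {M}\<close> makes \<open>M\<close> minimal among all vertex lattices.\<close>

lemma close_imp_neighbour:
  assumes A: "lattice A" "dual 2 A = A" and AM: "clique_close comparable vertex_lattices A M"
  shows "M \<in> neighbours A"
proof -
  obtain F where F: "A \<noteq> M" "A \<notin> F" "M \<notin> F"
    and CA: "maximal_clique comparable vertex_lattices (insert A F)"
    and CM: "maximal_clique comparable vertex_lattices (insert M F)"
    using AM by (auto simp: clique_close_def)
  have finF: "finite F" and chain: "pairwise comparable F" and FV: "F \<subseteq> vertex_lattices"
    and MV: "M \<in> vertex_lattices"
    and AF: "\<And>X. X \<in> F \<Longrightarrow> comparable A X" and MF: "\<And>X. X \<in> F \<Longrightarrow> comparable M X"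
    using CA CM F by (auto simp: maximal_clique_def pairwise_insert)
  have maxA: "X \<in> insert A F"
    if "X \<in> vertex_lattices" "\<And>Y. Y \<in> insert A F \<Longrightarrow> comparable X Y" for X
    by (rule maximal_chain_mem[OF CA that])
  have maxM: "X \<in> insert M F"
    if "X \<in> vertex_lattices" "\<And>Y. Y \<in> insert M F \<Longrightarrow> comparable X Y" for X
    by (rule maximal_chain_mem[OF CM that])
  have AsubF: "A \<subseteq> X" if X: "X \<in> F" for X
    using AF[OF X] self_dual_minimal[OF A(2)] X FV by (auto simp: comparable_def)
  \<comment> \<open>a lattice \<open>A + Ox\<close> could be added to the chain \<open>{A}\<close>\<close>
  have "F \<noteq> {}"
  proof
    assume "F = {}"
    obtain x where x: "x \<in> dual 1 A" "x \<notin> A" by (rule ex_not_mem_dual_one[OF A])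
    have "adjoin A x \<in> insert A F"
      using adjoin_vertex[OF A x(1)] \<open>F = {}\<close> subset_adjoin[of A x]
      by (intro maxA) (auto simp: comparable_def)
    then show False
      using \<open>F = {}\<close> mem_adjoin[OF self_dual_submod[OF A(2)], of x] x(2) by auto
  qed
  then obtain m where m: "m \<in> F" "\<And>X. X \<in> F \<Longrightarrow> m \<subseteq> X"
    using comparable_chain_min[OF finF _ chain] by metis
  have mV: "m \<in> vertex_lattices" and Am: "A \<subseteq> m" "A \<noteq> m" using m FV AsubF F by auto
  then obtain x where x: "x \<in> m" "x \<notin> A" by blast
  have "m \<subseteq> dual 1 m" using mV by (simp add: vertex_lattices_def)
  then have xd: "x \<in> dual 1 A" using x(1) dual_mono[OF Am(1), of 1] by blast
  have adj_m: "adjoin A x \<subseteq> m" by (intro adjoin_subset vertex_lattice_submod mV Am(1) x(1))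
  have "adjoin A x \<in> insert A F"
  proof (rule maxA[OF adjoin_vertex[OF A xd]])
    fix Y assume "Y \<in> insert A F"
    then show "comparable (adjoin A x) Y"
      using adj_m m(2)[of Y] subset_adjoin[of A x] by (auto simp: comparable_def)
  qed
  then have "adjoin A x \<in> F" using mem_adjoin[OF self_dual_submod[OF A(2)], of x] x(2) by auto
  then have m_eq: "m = adjoin A x" using m(2) adj_m by blast
  have "M \<subseteq> m"
  proof (rule ccontr)
    assume "\<not> M \<subseteq> m"
    then have "A \<subseteq> M" using MF[OF m(1)] Am by (auto simp: comparable_def)
    then have "M \<in> insert A F"
      using MF by (intro maxA MV) (auto simp: comparable_def)
    then show False using F by auto
  qed
  have "dual 2 M = M"
  proof (rule minimal_self_dual[OF MV])
    fix N assume N: "N \<in> vertex_lattices" "N \<subseteq> M"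
    have "N \<in> insert M F"
      using N(2) \<open>M \<subseteq> m\<close> m(2) by (intro maxM N(1)) (auto simp: comparable_def)
    then show "N = M"
    proof
      assume "N \<in> F"
      then have "m \<subseteq> N" by (rule m(2))
      then have "m = M" using N(2) \<open>M \<subseteq> m\<close> by blast
      then show ?thesis using m(1) F by blast
    qed
  qed
  then show "M \<in> neighbours A"
    unfolding neighbours_def using F(1) xd \<open>M \<subseteq> m\<close> m_eq by blast
qed

text \<open>Both \<open>A\<close> and \<open>M\<close> are minimal and covered by \<open>m = A + Oz\<close>. In a maximal chain through \<open>A\<close> and \<open>m\<close> every
element other than \<open>A\<close> contains \<open>m\<close>, so \<open>A\<close> can be exchanged for \<open>M\<close>.\<close>

lemma neighbour_imp_close:
  assumes A: "lattice A" "dual 2 A = A" and M: "M \<in> neighbours A"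
  shows "clique_close comparable vertex_lattices A M"
proof -
  obtain z where z: "z \<in> M" "z \<notin> A" "z \<in> dual 1 A" "M = neighbour A z"
    by (rule neighboursE[OF A(2) M])
  have M2: "dual 2 M = M" and ne: "M \<noteq> A" using M by (auto simp: neighbours_def)
  have latM: "lattice M" using lattice_neighbour[OF A z(3,2)] z(4) by simp
  note AV = self_dual_vertex[OF A] and MV = self_dual_vertex[OF latM M2]
  obtain y where y: "y \<in> A" "form z y = unif" by (rule ex_partner[OF A(2) z(3,2)])
  define m where "m = adjoin A z"
  have m_M: "m = adjoin M y" and yM: "y \<in> dual 1 M"
    using adjoin_neighbour[OF A(2) z(3) y] z(4) by (simp_all add: m_def)
  have mV: "m \<in> vertex_lattices" unfolding m_def by (rule adjoin_vertex[OF A z(3)])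
  have Am: "A \<subseteq> m" and Mm: "M \<subseteq> m" using subset_adjoin m_def m_M by auto
  have zm: "z \<in> m" using z(1) Mm by blast
  have mA: "m \<noteq> A" using zm z(2) by blast
  have mM: "\<not> m \<subseteq> M" using Am self_dual_antisym[OF M2 A(2)] ne by blast
  have coverA: "X = A \<or> X = m" if "X \<in> vertex_lattices" "A \<subseteq> X" "X \<subseteq> m" for X
    using adjoin_covers[OF A(2) z(3) vertex_lattice_submod] that by (simp add: m_def)
  have coverM: "X = M \<or> X = m" if "X \<in> vertex_lattices" "M \<subseteq> X" "X \<subseteq> m" for X
    using adjoin_covers[OF M2 yM vertex_lattice_submod] that by (simp add: m_M)
  have "pairwise comparable {A, m}" using Am by (auto simp: pairwise_def comparable_def)
  then obtain C where C: "{A, m} \<subseteq> C" "maximal_clique comparable vertex_lattices C"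
    using ex_maximal_clique[of A "{A, m}" vertex_lattices comparable] finite_comparable[OF A] AV mV
    by blast
  have finC: "finite C" and CV: "C \<subseteq> vertex_lattices" and chain: "pairwise comparable C"
    using C(2) by (simp_all add: maximal_clique_def)
  note maxC = maximal_chain_mem[OF C(2)]
  define F where "F = C - {A}"
  have mF: "m \<in> F" using C(1) mA by (auto simp: F_def)
  have mX: "m \<subseteq> X" if X: "X \<in> F" for X
  proof (rule ccontr)
    assume no: "\<not> m \<subseteq> X"
    have X': "X \<in> C" "X \<in> vertex_lattices" "X \<noteq> A" using X CV by (auto simp: F_def)
    then have "X \<subseteq> m" using no chain mF by (auto simp: F_def pairwise_def comparable_def)
    moreover have "comparable A X" using X' chain C(1) by (auto simp: pairwise_def)
    then have "A \<subseteq> X" using self_dual_minimal[OF A(2) X'(2)] by (auto simp: comparable_def)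
    ultimately show False using coverA X' no by blast
  qed
  have MX: "M \<subseteq> X" if "X \<in> F" for X using mX[OF that] Mm by blast
  have "M \<notin> F" using mX mM by blast
  moreover have "insert A F = C" using C(1) by (auto simp: F_def)
  moreover have "maximal_clique comparable vertex_lattices (insert M F)"
    unfolding maximal_clique_def
  proof (intro conjI ballI impI)
    show "finite (insert M F)" "insert M F \<subseteq> vertex_lattices"
      using finC CV MV by (auto simp: F_def)
    have "pairwise comparable F" using chain by (auto simp: F_def pairwise_def)
    then show "pairwise comparable (insert M F)"
      using MX by (auto simp: pairwise_insert comparable_def)
    fix X assume X: "X \<in> vertex_lattices"
      and "\<forall>Y\<in>insert M F. X \<noteq> Y \<longrightarrow> comparable X Y \<and> comparable Y X"
    then have comp: "comparable X Y" if "Y \<in> insert M F" for Y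
      using that by (cases "X = Y") (auto simp: comparable_def)
    show "X \<in> insert M F"
    proof (cases "m \<subseteq> X")
      case True
      have "X \<in> C"
      proof (rule maxC[OF X])
        fix Y assume "Y \<in> C"
        then show "comparable X Y"
          using comp[of Y] True Am by (cases "Y = A") (auto simp: F_def comparable_def)
      qed
      moreover have "X \<noteq> A" using True mA Am by blast
      ultimately show ?thesis by (simp add: F_def)
    next
      case False
      then have "X \<subseteq> m" using comp[of m] mF by (auto simp: comparable_def)
      moreover have "M \<subseteq> X"
        using comp[of M] self_dual_minimal[OF M2 X] by (auto simp: comparable_def)
      ultimately show ?thesis using coverM[OF X] False by blast
    qed
  qed
  ultimately show ?thesis
    unfolding clique_close_def using ne C(2) by (intro conjI exI[of _ F]) (auto simp: F_def)
qed

lemma close_to_minimal: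
  assumes A: "lattice A" "dual 2 A = A"
  defines "N \<equiv> {B. clique_close comparable vertex_lattices A B}"
  shows "finite N" "(card residue_field - 1) * card N = card residue_field * (card residue_field ^ (2 * n) - 1)"
proof -
  have "N = neighbours A"
    using close_imp_neighbour[OF A] neighbour_imp_close[OF A] by (auto simp: N_def)
  then show "finite N" "(card residue_field - 1) * card N = card residue_field * (card residue_field ^ (2 * n) - 1)"
    using card_neighbours[OF A] card_lines(2)[OF A] by (simp_all add: mult.left_commute)
qed

section \<open>Special vertices\<close>

text \<open>Dividing the form by \<open>\<pi>\<close> shifts the levels of all duals by one. This exchanges the roles of the two
kinds of special vertices.\<close>

lemma scaled_form: "nontrivial_symplectic_space ord unif scale (\<lambda>x y. form x y / unif) n"
proof -
  have lin: "Vector_Spaces.linear scale (*) (\<lambda>y. f y / unif)"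
    if "Vector_Spaces.linear scale (*) f" for f :: "'v \<Rightarrow> 'k"
    using that unfolding Vector_Spaces.linear_def module_hom_def module_hom_axioms_def
    by (simp add: add_divide_distrib)
  show ?thesis
  proof (intro nontrivial_symplectic_space.intro symplectic_space.intro
      symplectic_space_axioms.intro nontrivial_symplectic_space_axioms.intro)
    show "nonarch_local_field ord unif" "vector_space scale" by unfold_locales
    show "dim UNIV = 2 * n" by (rule dim_space)
    show "Vector_Spaces.linear scale (*) (\<lambda>y. form x y / unif)" for x
      by (rule lin[OF form_linear_right])
    show "Vector_Spaces.linear scale (*) (\<lambda>x. form x y / unif)" for y
      by (rule lin[OF form_linear_left])
    show "x = 0" if "\<And>y. form x y / unif = 0" for x
      using that form_nondegenerate[of x] unif_nonzero by simp
  qed (simp_all add: form_alternating n_pos)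
qed

text \<open>For a vertex lattice \<open>X\<close> the conditions \<open>dual 2 X \<subseteq> X \<subseteq> dual 1 X\<close> translate into
\<open>dual 3 Y \<subseteq> Y \<subseteq> dual 2 Y\<close> for \<open>Y = dual 2 X\<close>, which characterise vertex lattices of the form divided by
\<open>\<pi>\<close>. So \<open>dual 2\<close> is an inclusion-reversing bijection between the two posets, and it maps the maximal
element \<open>A\<close> to the minimal element \<open>\<pi>A\<close>.\<close>

lemma close_to_maximal:
  assumes A: "lattice A" "dual 1 A = A"
  defines "N \<equiv> {B. clique_close comparable vertex_lattices A B}"
  shows "finite N" "(card residue_field - 1) * card N = card residue_field * (card residue_field ^ (2 * n) - 1)"
proof -
  interpret S': nontrivial_symplectic_space ord unif scale "\<lambda>x y. form x y / unif" n
    by (rule scaled_form)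
  have val: "val_ge (x / unif) j \<longleftrightarrow> val_ge x (j + 1)" for x j
    using val_ge_cancel[of "inverse unif" x j] unif_nonzero
    by (simp add: divide_inverse mult.commute ord_inverse ord_unif)
  have dual': "S'.dual j X = dual (j + 1) X" for j X
    by (auto simp: S'.dual_def dual_def val)
  have V': "S'.vertex_lattices = {X. lattice X \<and> dual 3 X \<subseteq> X \<and> X \<subseteq> dual 2 X}"
    by (simp add: S'.vertex_lattices_def dual')
  have V: "lattice X" "dual 2 X \<subseteq> X" "X \<subseteq> dual 1 X" if "X \<in> vertex_lattices" for X
    using that by (auto simp: vertex_lattices_def)
  have lat_dual: "lattice (dual 2 X)" if X: "lattice X" "dual 2 X \<subseteq> X" "X \<subseteq> dual 1 X" for X
  proof (rule lattice_sandwich[OF X(1) submod_dual _ X(2)])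
    show "scale unif ` X \<subseteq> dual 2 X" using image_mono[OF X(3), of "scale unif"] scale_unif_dual[of 1 X] by simp
  qed
  have lat_dual': "lattice (dual 2 X)" if X: "lattice X" "dual 3 X \<subseteq> X" "X \<subseteq> dual 2 X" for X
  proof -
    have "lattice (dual 3 X)"
    proof (rule lattice_sandwich[OF X(1) submod_dual _ X(2)])
      show "scale unif ` X \<subseteq> dual 3 X" using image_mono[OF X(3), of "scale unif"] scale_unif_dual[of 2 X] by simp
    qed
    then have "lattice (scale (inverse unif) ` dual 3 X)"
      using unif_nonzero by (intro lattice_scale_image) simp_all
    also have "scale (inverse unif) ` dual 3 X = dual 2 X"
      using scale_dual[of "inverse unif" 3 X] unif_nonzero by (simp add: ord_inverse ord_unif)
    finally show ?thesis .
  qed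
  have bij: "bij_betw (dual 2) vertex_lattices S'.vertex_lattices"
  proof (rule bij_betw_byWitness[where f' = "dual 2"])
    show "\<forall>X\<in>vertex_lattices. dual 2 (dual 2 X) = X" "\<forall>X\<in>S'.vertex_lattices. dual 2 (dual 2 X) = X"
      by (auto simp: vertex_lattices_def V' dual_dual)
    show "dual 2 ` vertex_lattices \<subseteq> S'.vertex_lattices"
    proof (clarsimp simp: V')
      fix X assume "X \<in> vertex_lattices"
      note X = V[OF this]
      have "dual 3 (dual 2 X) = scale unif ` X"
        using scale_unif_dual[of 2 "dual 2 X"] dual_dual[OF X(1), of 2] by simp
      also have "\<dots> \<subseteq> dual 2 X" using image_mono[OF X(3), of "scale unif"] scale_unif_dual[of 1 X] by simp
      finally show "lattice (dual 2 X) \<and> dual 3 (dual 2 X) \<subseteq> dual 2 X \<and> dual 2 X \<subseteq> dual 2 (dual 2 X)"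
        using lat_dual[OF X] X(2) dual_dual[OF X(1), of 2] by simp
    qed
    show "dual 2 ` S'.vertex_lattices \<subseteq> vertex_lattices"
    proof (clarsimp simp: V' vertex_lattices_def)
      fix X assume X: "lattice X" "dual 3 X \<subseteq> X" "X \<subseteq> dual 2 X"
      have "scale unif ` dual 2 X \<subseteq> scale unif ` dual 1 (dual 2 X)"
        using X(2) scale_unif_dual[of 2 X] scale_unif_dual[of 1 "dual 2 X"] dual_dual[OF X(1), of 2]
        by simp
      then have "dual 2 X \<subseteq> dual 1 (dual 2 X)"
        by (simp add: scale_unif_subset scale_image_scale_image unif_nonzero)
      then show "lattice (dual 2 X) \<and> dual 2 (dual 2 X) \<subseteq> dual 2 X \<and> dual 2 X \<subseteq> dual 1 (dual 2 X)"
        using lat_dual'[OF X] X(3) dual_dual[OF X(1), of 2] by simp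
    qed
  qed
  have AV: "A \<in> vertex_lattices"
    using A dual_level_mono[of 1 2 A] by (simp add: vertex_lattices_def)
  have comp: "comparable X Y \<longleftrightarrow> comparable (dual 2 X) (dual 2 Y)"
    if "X \<in> vertex_lattices" "Y \<in> vertex_lattices" for X Y
  proof -
    have "X \<subseteq> Y \<longleftrightarrow> dual 2 Y \<subseteq> dual 2 X" if XY: "X \<in> vertex_lattices" "Y \<in> vertex_lattices" for X Y
      using dual_mono[of X Y 2] dual_mono[of "dual 2 Y" "dual 2 X" 2]
        dual_dual[OF V(1)[OF XY(1)], of 2] dual_dual[OF V(1)[OF XY(2)], of 2] by auto
    then show ?thesis using that unfolding comparable_def by blast
  qed
  have image: "{B. clique_close comparable S'.vertex_lattices (dual 2 A) B} = dual 2 ` N"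
    unfolding N_def by (rule clique_close_Collect_image[where S = comparable, OF bij comp AV])
  have "N \<subseteq> vertex_lattices" using clique_close_mem by (auto simp: N_def)
  then have inj: "inj_on (dual 2) N" using bij by (meson bij_betw_def inj_on_subset)
  have "S'.dual 2 (dual 2 A) = dual 2 A"
    using scale_unif_dual[of 2 "dual 2 A"] scale_unif_dual[of 1 A] dual_dual[OF A(1), of 2] A(2)
    by (simp add: dual')
  moreover have "lattice (dual 2 A)" by (rule lat_dual[OF V[OF AV]])
  ultimately have "finite (dual 2 ` N)"
    "(card residue_field - 1) * card (dual 2 ` N) = card residue_field * (card residue_field ^ (2 * n) - 1)"
    using S'.close_to_minimal[of "dual 2 A"] image by simp_all
  then show "finite N" "(card residue_field - 1) * card N = card residue_field * (card residue_field ^ (2 * n) - 1)"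
    using finite_imageD[OF _ inj] card_image[OF inj] by simp_all
qed

text \<open>The difference of both sides is orthogonal to all basis vectors.\<close>

lemma symplectic_basis_expansion:
  assumes "symplectic_basis u w"
  shows "x = (\<Sum>i\<in>{1..n}. scale (form x (w i)) (u i) - scale (form x (u i)) (w i))"
proof -
  have uw: "form (u i) (w j) = (if i = j then 1 else 0)" "form (u i) (u j) = 0" "form (w i) (w j) = 0"
    "form (w i) (u j) = (if i = j then - 1 else 0)"
    if "i \<in> {1..n}" "j \<in> {1..n}" for i j
    using assms that form_commute[of "w i" "u j"] by (auto simp: symplectic_basis_def)
  define d where "d = x - (\<Sum>i\<in>{1..n}. scale (form x (w i)) (u i) - scale (form x (u i)) (w i))"
  have dw: "form d (w j) = 0" and du: "form d (u j) = 0" if j: "j \<in> {1..n}" for j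
  proof -
    have "(\<Sum>i\<in>{1..n}. form x (w i) * form (u i) (w j) - form x (u i) * form (w i) (w j)) =
        (\<Sum>i\<in>{1..n}. if i = j then form x (w i) else 0)"
      by (intro sum.cong refl) (use uw j in auto)
    then show "form d (w j) = 0" using j by (simp add: d_def form_simps form_sum_left)
    have "(\<Sum>i\<in>{1..n}. form x (w i) * form (u i) (u j) - form x (u i) * form (w i) (u j)) =
        (\<Sum>i\<in>{1..n}. if i = j then form x (u i) else 0)"
      by (intro sum.cong refl) (use uw j in auto)
    then show "form d (u j) = 0" using j by (simp add: d_def form_simps form_sum_left)
  qed
  have "subspace {y. form d y = 0}" by (auto simp: subspace_def form_simps)
  then have "span (u ` {1..n} \<union> w ` {1..n}) \<subseteq> {y. form d y = 0}"
    using du dw by (intro span_minimal) auto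
  then have "form d y = 0" for y using assms by (auto simp: symplectic_basis_def)
  then have "d = 0" by (rule form_nondegenerate)
  then show ?thesis by (simp add: d_def)
qed

lemma symplectic_lattice_self_dual:
  fixes a :: "nat \<Rightarrow> int" and \<mu> :: int
  assumes "symplectic_basis u w"
  defines "S \<equiv> (\<lambda>i. scale (unif powi a i) (u i)) ` {1..n} \<union> (\<lambda>i. scale (unif powi (\<mu> - a i)) (w i)) ` {1..n}"
  shows "dual \<mu> (O_span S) = O_span S"
proof
  have uw: "form (u i) (w j) = (if i = j then 1 else 0)" "form (u i) (u j) = 0" "form (w i) (w j) = 0"
    "form (w i) (u j) = (if i = j then - 1 else 0)"
    if "i \<in> {1..n}" "j \<in> {1..n}" for i j
    using assms(1) that form_commute[of "w i" "u j"] by (auto simp: symplectic_basis_def)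
  have pow: "val_ge (unif powi a i * unif powi (\<mu> - a i)) \<mu>" "val_ge (unif powi (\<mu> - a i) * unif powi a i) \<mu>"
    for i using unif_nonzero by (simp_all add: val_ge_def ord_mult)
  have "S \<subseteq> dual \<mu> S"
  proof (intro subsetI dualI)
    fix x y assume "x \<in> S" "y \<in> S"
    then show "val_ge (form x y) \<mu>"
      unfolding S_def by (elim UnE imageE) (auto simp: form_simps uw pow)
  qed
  then have "O_span S \<subseteq> dual \<mu> S" by (intro O_span_minimal submod_dual)
  then have "S \<subseteq> dual \<mu> (O_span S)" by (subst subset_dual_commute)
  then show "O_span S \<subseteq> dual \<mu> (O_span S)" by (intro O_span_minimal submod_dual)
  show "dual \<mu> (O_span S) \<subseteq> O_span S"
  proof
    fix x assume x: "x \<in> dual \<mu> (O_span S)"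
    have S: "scale (unif powi a i) (u i) \<in> O_span S" "scale (unif powi (\<mu> - a i)) (w i) \<in> O_span S"
      if "i \<in> {1..n}" for i using that by (auto simp: S_def intro!: O_span_base)
    have "scale (form x (w i)) (u i) - scale (form x (u i)) (w i) \<in> O_span S" if i: "i \<in> {1..n}" for i
    proof (rule submod_diff[OF submod_O_span])
      have "val_ge (form x (w i)) (a i)"
        using dualD[OF x S(2)[OF i]] by (simp add: form_scale_right val_ge_cancel unif_nonzero)
      then have "val_ge (form x (w i) / unif powi a i) 0"
        using val_ge_divide[of "form x (w i)" "a i" "unif powi a i"] by (simp add: unif_nonzero)
      then have "scale (form x (w i) / unif powi a i) (scale (unif powi a i) (u i)) \<in> O_span S"
        by (rule submod_scale[OF submod_O_span _ S(1)[OF i]])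
      then show "scale (form x (w i)) (u i) \<in> O_span S" by (simp add: unif_nonzero)
      have "val_ge (form x (u i)) (\<mu> - a i)"
        using dualD[OF x S(1)[OF i]] by (simp add: form_scale_right val_ge_cancel unif_nonzero)
      then have "val_ge (form x (u i) / unif powi (\<mu> - a i)) 0"
        using val_ge_divide[of "form x (u i)" "\<mu> - a i" "unif powi (\<mu> - a i)"] by (simp add: unif_nonzero)
      then have "scale (form x (u i) / unif powi (\<mu> - a i)) (scale (unif powi (\<mu> - a i)) (w i)) \<in> O_span S"
        by (rule submod_scale[OF submod_O_span _ S(2)[OF i]])
      then show "scale (form x (u i)) (w i) \<in> O_span S" by (simp add: unif_nonzero)
    qed
    then show "x \<in> O_span S"
      by (subst symplectic_basis_expansion[OF assms(1)]) (rule submod_sum[OF submod_O_span])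
  qed
qed

text \<open>On the given representative the form is \<open>\<pi>\<^sup>\<mu>\<close> times a unimodular one. Rescaling changes \<open>\<mu>\<close> by an even
number, and only the levels 1 and 2 are compatible with \<open>dual 2 A \<subseteq> A \<subseteq> dual 1 A\<close>.\<close>

lemma special_vertex_lattice:
  assumes "special t"
  obtains A where "A \<in> vertex_lattices" "t = homothety_class A" "dual 2 A = A \<or> dual 1 A = A"
proof -
  obtain L \<mu> where L: "t = homothety_class L" "dual \<mu> L = L"
  proof -
    obtain u w a \<mu> where uw: "symplectic_basis u w" and
      t: "t = homothety_class (O_span ((\<lambda>i. scale (unif powi a i) (u i)) ` {1..n} \<union>
        (\<lambda>i. scale (unif powi (\<mu> - a i)) (w i)) ` {1..n}))"
      using assms unfolding special_def by blast
    show ?thesis by (rule that[OF t symplectic_lattice_self_dual[OF uw]])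
  qed
  have "t \<in> vertices" using assms by (simp add: special_def)
  then obtain A where A: "A \<in> vertex_lattices" "t = homothety_class A" by (auto simp: vertices_eq)
  have AV: "lattice A" "dual 2 A \<subseteq> A" "A \<subseteq> dual 1 A" using A by (auto simp: vertex_lattices_def)
  have "A \<in> homothety_class L" using A(2) L(1) homothety_class_self[of A] by simp
  then obtain b where b: "b \<noteq> 0" "A = scale b ` L" by (auto simp: homothety_class_def)
  define m where "m = \<mu> + 2 * ord b"
  have "A = dual (\<mu> + ord b) L" using b scale_dual[OF b(1), of \<mu> L] L(2) by simp
  then have m: "dual m A = A" using dual_scale[OF b(1), of m L] b(2) by (simp add: m_def add.commute)
  have no: "\<not> A \<subseteq> scale unif ` A" by (rule lattice_not_subset_unif[OF AV(1)])
  have "m < 3"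
  proof (rule ccontr)
    assume "\<not> m < 3"
    then have "A \<subseteq> dual 3 A" using m dual_level_mono[of 3 m A] by simp
    also have "\<dots> \<subseteq> scale unif ` A" using image_mono[OF AV(2), of "scale unif"] scale_unif_dual[of 2 A] by simp
    finally show False using no by blast
  qed
  moreover have "m > 0"
  proof (rule ccontr)
    assume "\<not> m > 0"
    then have "dual 0 A \<subseteq> A" using m dual_level_mono[of m 0 A] by simp
    then have "dual 1 A \<subseteq> scale unif ` A" using image_mono scale_unif_dual[of 0 A] by fastforce
    then show False using no AV(3) by blast
  qed
  ultimately have "m = 2 \<or> m = 1" by linarith
  then show ?thesis using that[OF A] m by blast
qed

lemma card_close_special:
  assumes "special t"
  shows "finite {t'. close t t'}"
    and "(card residue_field - 1) * card {t'. close t t'} =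
      card residue_field * (card residue_field ^ (2 * n) - 1)"
proof -
  obtain A where A: "A \<in> vertex_lattices" "t = homothety_class A" "dual 2 A = A \<or> dual 1 A = A"
    by (rule special_vertex_lattice[OF assms])
  define N where "N = {B. clique_close comparable vertex_lattices A B}"
  have bij: "bij_betw homothety_class vertex_lattices vertices"
    by (simp add: bij_betw_def inj_on_homothety_class vertices_eq)
  have close: "{t'. close t t'} = homothety_class ` N"
    unfolding close_iff_clique_close A(2) N_def
    by (rule clique_close_Collect_image[where S = incident, OF bij incident_iff[symmetric] A(1)])
  have "N \<subseteq> vertex_lattices" using clique_close_mem by (auto simp: N_def)
  then have inj: "inj_on homothety_class N" using inj_on_homothety_class inj_on_subset by blast
  have "lattice A" using A(1) by (simp add: vertex_lattices_def)
  then have "finite N"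
    "(card residue_field - 1) * card N = card residue_field * (card residue_field ^ (2 * n) - 1)"
    using close_to_minimal[of A] close_to_maximal[of A] A(3) unfolding N_def by blast+
  then show "finite {t'. close t t'}" "(card residue_field - 1) * card {t'. close t t'} =
      card residue_field * (card residue_field ^ (2 * n) - 1)"
    using close card_image[OF inj] by simp_all
qed

lemma card_residue_field_ge: "card residue_field \<ge> 2"
proof -
  have "residue_class 0 \<noteq> residue_class 1"
    by (simp add: residue_class_eq_iff val_ge_def)
  then have "card {residue_class 0, residue_class 1} = 2" by simp
  moreover have "{residue_class 0, residue_class 1} \<subseteq> residue_field"
    by (auto simp: residue_field_def intro!: imageI)
  ultimately show ?thesis using card_mono[OF finite_residue_field] by metis
qed

end

theorem proposition2p9:
  fixes ord :: "'k::field \<Rightarrow> int" and unif :: 'k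
    and scale :: "'k \<Rightarrow> 'v::ab_group_add \<Rightarrow> 'v"
    and form :: "'v \<Rightarrow> 'v \<Rightarrow> 'k" and n q :: nat and t :: "'v set set"
  assumes "symplectic_space ord unif scale form n"
    and "n \<ge> 2"
    and "q = card (discretely_valued_field.residue_field ord unif)"
    and "symplectic_space.special ord unif scale form n t"
  shows "finite {t'. symplectic_space.close ord unif scale form n t t'} \<and>
    real (card {t'. symplectic_space.close ord unif scale form n t t'}) =
      (real q ^ (2 * n) - 1) / (real q - 1) * real q"
proof -
  interpret symplectic_space ord unif scale form n by (rule assms(1))
  interpret nontrivial_symplectic_space ord unif scale form n
    by unfold_locales (use assms(2) in simp)
  let ?N = "{t'. close t t'}"
  have q: "q = card residue_field" "q \<ge> 2" using assms(3) card_residue_field_ge by simp_all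
  note N = card_close_special[OF assms(4)]
  have "(q - 1) * card ?N = q * (q ^ (2 * n) - 1)" using N(2) q(1) by simp
  then have "real (q - 1) * real (card ?N) = real q * real (q ^ (2 * n) - 1)"
    by (metis of_nat_mult)
  moreover have "1 \<le> q" "1 \<le> q ^ (2 * n)" using q(2) by simp_all
  ultimately have "(real q - 1) * real (card ?N) = real q * (real q ^ (2 * n) - 1)"
    by (simp add: of_nat_diff)
  then have "real (card ?N) = (real q ^ (2 * n) - 1) / (real q - 1) * real q"
    using q(2) by (simp add: field_simps)
  with N(1) show ?thesis by blast
qed

end
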